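(* Let $B\subset\Omega$ and let $(u_B,y_B,p_B)$ be a solution of $(\mathbf P_B)$. Then for almost all $x\in\Omega$ the topological derivative $DJ(B)(x)$ exists, and it is given by $$DJ(B)(x)=\sigma(B,x)\,\bigl(\beta(x)+\bar H(p_B(x))\bigr),\qquad \sigma(B,x):=\begin{cases}+1&\text{if }x\notin B,\\-1&\text{if }x\in B.\end{cases}$$
   Context: Setting: $\Omega\subset\mathbb R^d$ is Lebesgue measurable with $|\Omega|<\infty$ ($|\cdot|$ is Lebesgue measure); all subsets of $\Omega$ considered are Lebesgue measurable. $Y$ is a real Hilbert space, $S:L^2(\Omega)\to Y$ is bounded linear with Hilbert space adjoint $S^*:Y\to L^2(\Omega)$, and $y_d\in Y$. $g:\mathbb R\to\mathbb R\cup\{+\infty\}$ is proper, convex, lower semicontinuous, $g\ge0$, and $g(u)=0$ if and only if $u=0$; with $\operatorname{dom}g=\{u:g(u)<+\infty\}$ there is $\mu>0$ such that $\frac\mu2\lambda(1-\lambda)|u-v|^2+g(\lambda u+(1-\lambda)v)\le\lambda g(u)+(1-\lambda)g(v)$ for all $u,v\in\operatorname{dom}g$, $\lambda\in(0,1)$. There is $q>6$ such that $S^*S$ is a bounded linear map from $L^2(\Omega)$ to $L^q(\Omega)$ and $S^*y_d\in L^q(\Omega)$. $\beta\in L^1(\Omega)$. Notation: for $u\in L^2(\Omega)$ and $A\subset\Omega$, $J(u,A):=\frac12\|S(\chi_Au)-y_d\|_Y^2+\int_\Omega g(u(x))+\chi_A(x)\beta(x)\,dx$, where $\chi_A$ is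 the characteristic function of $A$. $(\mathbf P_A)$ is the problem $\min_{u\in L^2(\Omega)}J(u,A)$, and $J(A):=\min_{u\in L^2(\Omega)}J(u,A)$ is the value function. A solution of $(\mathbf P_A)$ is a triple $(u_A,y_A,p_A)$ where $u_A$ is a minimizer of $J(\cdot,A)$, $y_A:=S(\chi_Au_A)$ and $p_A:=S^*(y_A-y_d)$. $\bar H(p):=\min_{u\in\mathbb R}(pu+g(u))$ for $p\in\mathbb R$. Topological derivative: with $B_r(x)$ the open ball of radius $r$ centered at $x$ and $|B_r|$ its measure, $DJ(B)(x):=\lim_{r\searrow0}\frac{J((B\cup B_r(x))\cap\Omega)-J(B)}{|B_r|}$ if $x\notin B$, and $DJ(B)(x):=\lim_{r\searrow0}\frac{J(B\setminus B_r(x))-J(B)}{|B_r|}$ if $x\in B$. *)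

theory Defs
  imports "HOL-Analysis.Analysis"
begin

text \<open>
  Elements of \<open>L\<^sup>p(\<Omega>)\<close> are represented by functions, with \<open>M = lebesgue_on \<Omega>\<close>; only their
  values on \<open>\<Omega>\<close> matter, and identities between elements hold almost everywhere.
\<close>

definition Lp :: "'a measure \<Rightarrow> real \<Rightarrow> ('a \<Rightarrow> real) set" where
  "Lp M p = {u \<in> borel_measurable M. integrable M (\<lambda>x. \<bar>u x\<bar> powr p)}"

definition Lp_norm :: "'a measure \<Rightarrow> real \<Rightarrow> ('a \<Rightarrow> real) \<Rightarrow> real" where
  "Lp_norm M p u = (\<integral>x. \<bar>u x\<bar> powr p \<partial>M) powr (1 / p)"

text \<open>
  Linearity together with the bound by the seminorm makes such an operator invariant under changing
  its argument on a null set, so it is an operator on the space of equivalence classes.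
\<close>

definition bounded_linear_on_Lp ::
    "'a measure \<Rightarrow> real \<Rightarrow> (('a \<Rightarrow> real) \<Rightarrow> 'y::real_normed_vector) \<Rightarrow> bool" where
  "bounded_linear_on_Lp M p T \<longleftrightarrow>
     (\<forall>u\<in>Lp M p. \<forall>v\<in>Lp M p. T (\<lambda>x. u x + v x) = T u + T v) \<and>
     (\<forall>c. \<forall>u\<in>Lp M p. T (\<lambda>x. c * u x) = c *\<^sub>R T u) \<and>
     (\<exists>C. \<forall>u\<in>Lp M p. norm (T u) \<le> C * Lp_norm M p u)"

definition bounded_linear_Lp_Lq ::
    "'a measure \<Rightarrow> real \<Rightarrow> real \<Rightarrow> (('a \<Rightarrow> real) \<Rightarrow> ('a \<Rightarrow> real)) \<Rightarrow> bool" where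
  "bounded_linear_Lp_Lq M p q T \<longleftrightarrow>
     (\<forall>u\<in>Lp M p. T u \<in> Lp M q) \<and>
     (\<forall>u\<in>Lp M p. \<forall>v\<in>Lp M p. AE x in M. T (\<lambda>x. u x + v x) x = T u x + T v x) \<and>
     (\<forall>c. \<forall>u\<in>Lp M p. AE x in M. T (\<lambda>x. c * u x) x = c * T u x) \<and>
     (\<exists>C. \<forall>u\<in>Lp M p. Lp_norm M q (T u) \<le> C * Lp_norm M p u)"

definition is_L2_adjoint ::
    "'a measure \<Rightarrow> (('a \<Rightarrow> real) \<Rightarrow> 'y::real_inner) \<Rightarrow> ('y \<Rightarrow> 'a \<Rightarrow> real) \<Rightarrow> bool" where
  "is_L2_adjoint M S Sadj \<longleftrightarrow>
     (\<forall>y. Sadj y \<in> Lp M 2) \<and>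
     (\<forall>y. \<forall>u\<in>Lp M 2. S u \<bullet> y = (\<integral>x. u x * Sadj y x \<partial>M))"

definition proper_fun :: "(real \<Rightarrow> ereal) \<Rightarrow> bool" where
  "proper_fun g \<longleftrightarrow> (\<forall>u. g u \<noteq> -\<infinity>) \<and> (\<exists>u. g u \<noteq> \<infinity>)"

definition convex_fun :: "(real \<Rightarrow> ereal) \<Rightarrow> bool" where
  "convex_fun g \<longleftrightarrow>
     (\<forall>u v. \<forall>t\<in>{0<..<1::real}.
        g (t * u + (1 - t) * v) \<le> ereal t * g u + ereal (1 - t) * g v)"

definition lower_semicontinuous :: "(real \<Rightarrow> ereal) \<Rightarrow> bool" where
  "lower_semicontinuous g \<longleftrightarrow> (\<forall>u. g u \<le> Liminf (at u) g)"

definition eff_dom :: "(real \<Rightarrow> ereal) \<Rightarrow> real set" where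
  "eff_dom g = {u. g u < \<infinity>}"

definition strongly_convex_fun :: "real \<Rightarrow> (real \<Rightarrow> ereal) \<Rightarrow> bool" where
  "strongly_convex_fun \<mu> g \<longleftrightarrow>
     (\<forall>u\<in>eff_dom g. \<forall>v\<in>eff_dom g. \<forall>t\<in>{0<..<1::real}.
        ereal (\<mu> / 2 * t * (1 - t) * \<bar>u - v\<bar>\<^sup>2) + g (t * u + (1 - t) * v)
          \<le> ereal t * g u + ereal (1 - t) * g v)"

text \<open>
  Positive part minus negative part; \<^const>\<open>e2ennreal\<close> sends negative numbers to 0.  It is used below
  only for functions whose negative part has finite integral.
\<close>

definition ext_integral :: "'a measure \<Rightarrow> ('a \<Rightarrow> ereal) \<Rightarrow> ereal" where
  "ext_integral M f =
     enn2ereal (\<integral>\<^sup>+x. e2ennreal (f x) \<partial>M) - enn2ereal (\<integral>\<^sup>+x. e2ennreal (- f x) \<partial>M)"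

text \<open>
  The minimum, as a real number, of an extended real valued function: it is attained and finite,
  and nothing is specified if no such number exists.
\<close>

definition min_value :: "('b \<Rightarrow> ereal) \<Rightarrow> 'b set \<Rightarrow> real" where
  "min_value f X = (THE m. (\<exists>u\<in>X. f u = ereal m) \<and> (\<forall>v\<in>X. ereal m \<le> f v))"

definition cost ::
    "'a::euclidean_space set \<Rightarrow> (('a \<Rightarrow> real) \<Rightarrow> 'y::real_inner) \<Rightarrow> 'y \<Rightarrow> (real \<Rightarrow> ereal) \<Rightarrow> ('a \<Rightarrow> real)
      \<Rightarrow> ('a \<Rightarrow> real) \<Rightarrow> 'a set \<Rightarrow> ereal" where
  "cost \<Omega> S yd g \<beta> u A =
     ereal (1 / 2 * (norm (S (\<lambda>x. indicator A x * u x) - yd))\<^sup>2)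
     + ext_integral (lebesgue_on \<Omega>) (\<lambda>x. g (u x) + ereal (indicator A x * \<beta> x))"

definition value_function ::
    "'a::euclidean_space set \<Rightarrow> (('a \<Rightarrow> real) \<Rightarrow> 'y::real_inner) \<Rightarrow> 'y \<Rightarrow> (real \<Rightarrow> ereal) \<Rightarrow> ('a \<Rightarrow> real)
      \<Rightarrow> 'a set \<Rightarrow> real" where
  "value_function \<Omega> S yd g \<beta> A = min_value (\<lambda>u. cost \<Omega> S yd g \<beta> u A) (Lp (lebesgue_on \<Omega>) 2)"

definition is_solution ::
    "'a::euclidean_space set \<Rightarrow> (('a \<Rightarrow> real) \<Rightarrow> 'y::real_inner) \<Rightarrow> ('y \<Rightarrow> 'a \<Rightarrow> real) \<Rightarrow> 'y
      \<Rightarrow> (real \<Rightarrow> ereal) \<Rightarrow> ('a \<Rightarrow> real) \<Rightarrow> 'a set \<Rightarrow> ('a \<Rightarrow> real) \<Rightarrow> 'y \<Rightarrow> ('a \<Rightarrow> real) \<Rightarrow> bool" where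
  "is_solution \<Omega> S Sadj yd g \<beta> A u y p \<longleftrightarrow>
     is_arg_min (\<lambda>v. cost \<Omega> S yd g \<beta> v A) (\<lambda>v. v \<in> Lp (lebesgue_on \<Omega>) 2) u \<and>
     y = S (\<lambda>x. indicator A x * u x) \<and>
     p \<in> Lp (lebesgue_on \<Omega>) 2 \<and> (AE x in lebesgue_on \<Omega>. p x = Sadj (y - yd) x)"

definition H_bar :: "(real \<Rightarrow> ereal) \<Rightarrow> real \<Rightarrow> real" where
  "H_bar g p = min_value (\<lambda>u. ereal (p * u) + g u) UNIV"

definition has_topological_derivative ::
    "'a::euclidean_space set \<Rightarrow> ('a set \<Rightarrow> real) \<Rightarrow> 'a set \<Rightarrow> 'a \<Rightarrow> real \<Rightarrow> bool" where
  "has_topological_derivative \<Omega> J B x D \<longleftrightarrow>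
     (if x \<in> B
      then ((\<lambda>r. (J (B - ball x r) - J B) / measure lebesgue (ball x r)) \<longlongrightarrow> D) (at_right 0)
      else ((\<lambda>r. (J ((B \<union> ball x r) \<inter> \<Omega>) - J B) / measure lebesgue (ball x r)) \<longlongrightarrow> D) (at_right 0))"

definition top_sign :: "'a set \<Rightarrow> 'a \<Rightarrow> real" where
  "top_sign B x = (if x \<in> B then - 1 else 1)"

end

theory Submission
  imports Defs
begin

text \<open>
  Let \<open>w x\<close> minimise \<open>p\<^sub>B x * v + g v\<close> over all numbers \<open>v\<close>, so that the minimal value is \<open>H_bar g (p\<^sub>B x)\<close>,
  and put \<open>h = \<beta> + H_bar g \<circ> p\<^sub>B\<close>.  The heart of the proof is the two-sided estimate, for every
  measurable \<open>A \<subseteq> \<Omega>\<close>,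

  \<open>0 \<le> J(A) - J(B) - \<integral>(\<chi>\<^sub>A - \<chi>\<^sub>B) h \<le> 1/2 \<parallel>S ((\<chi>\<^sub>A - \<chi>\<^sub>B) w)\<parallel>\<^sup>2\<close>.

  It comes from expanding the square around the optimal state \<open>y\<^sub>B\<close>.  For every control \<open>v\<close>
  and every \<open>A\<close>, the cost is a constant independent of \<open>v\<close> and \<open>A\<close> plus
  \<open>\<integral>(\<chi>\<^sub>A p\<^sub>B v + g(v) + \<chi>\<^sub>A \<beta>)\<close> plus \<open>1/2 \<parallel>S (\<chi>\<^sub>A v) - y\<^sub>B\<parallel>\<^sup>2\<close>
  (lemma \<open>real_cost_expansion\<close>).  Dropping the last term and minimising the integrand pointwise gives the
  lower bound, inserting \<open>v = \<chi>\<^sub>A w\<close> gives the upper bound.  Both are exact at \<open>A = B\<close>, because the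
  optimal control agrees with \<open>w\<close> on \<open>B\<close>: this is the first-order optimality condition
  (\<open>variational_inequality\<close>, \<open>u_eq_w\<close>).  No information about the solutions for sets other than \<open>B\<close> enters,
  except that they exist.

  The error is \<open>o(|B\<^sub>r|)\<close> when \<open>A\<close> and \<open>B\<close> differ only inside a ball \<open>B\<^sub>r\<close>.  Since \<open>S\<^sup>*S\<close> maps \<open>L\<^sup>2\<close>
  to \<open>L\<^sup>q\<close> with \<open>q > 2\<close>, the ratio \<open>\<parallel>S v\<parallel>\<^sup>2 / \<parallel>v\<parallel>\<^sup>2\<close> tends to zero uniformly as the measure of the support of
  \<open>v\<close> does (\<open>S_small_on_small_sets\<close>), and the mean of \<open>w\<^sup>2\<close> over \<open>B\<^sub>r\<close> stays bounded at Lebesgue points.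
  The main term, divided by \<open>|B\<^sub>r|\<close>, converges to \<open>\<plusminus>h x\<close> at Lebesgue points.  So the theorem follows from
  Lebesgue's differentiation theorem, which is derived here from Vitali's covering theorem.

  Finally, \<open>J(A)\<close> is a value that is attained (\<open>minimizer_exists\<close>): by strong convexity a minimising sequence
  is Cauchy in \<open>L\<^sup>2\<close>, and Fatou's lemma passes to the limit in the integral of \<open>g\<close>.
\<close>

section \<open>Lebesgue differentiation\<close>

text \<open>
  Cut \<open>\<bar>f\<bar>\<close> at a level \<open>n\<close>: by dominated convergence the part above the level has small integral over the whole
  space once \<open>n\<close> is large, and the part below it contributes at most \<open>n\<close> times the measure of the set.
\<close>

lemma integral_small_on_small_sets:
  fixes f :: "'a \<Rightarrow> real"
  assumes f: "integrable M f" and "\<epsilon> > 0"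
  obtains \<delta> where "\<delta> > 0"
    "\<And>E. \<lbrakk>E \<in> sets M; emeasure M E < ennreal \<delta>\<rbrakk> \<Longrightarrow> (LINT x:E|M. \<bar>f x\<bar>) < \<epsilon>"
proof -
  define s where "s = (\<lambda>(n::nat) x. indicator {x. \<bar>f x\<bar> > real n} x * \<bar>f x\<bar>)"
  have [measurable]: "f \<in> borel_measurable M" using f by auto
  have "(\<lambda>n. \<integral>x. s n x \<partial>M) \<longlonglongrightarrow> (\<integral>x. 0 \<partial>M)"
  proof (rule integral_dominated_convergence[where w = "\<lambda>x. \<bar>f x\<bar>"])
    show "AE x in M. (\<lambda>n. s n x) \<longlonglongrightarrow> 0"
    proof (rule AE_I2)
      fix x
      obtain N where N: "\<bar>f x\<bar> \<le> real N" using real_arch_simple by blast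
      have "eventually (\<lambda>n. s n x = 0) sequentially"
        using eventually_ge_at_top[of N] by eventually_elim (use N in \<open>auto simp: s_def indicator_def\<close>)
      then show "(\<lambda>n. s n x) \<longlonglongrightarrow> 0" by (rule tendsto_eventually)
    qed
  qed (use f in \<open>auto simp: s_def indicator_def\<close>)
  then have "eventually (\<lambda>n. (\<integral>x. s n x \<partial>M) < \<epsilon> / 2) sequentially"
    using \<open>\<epsilon> > 0\<close> by (intro order_tendstoD) auto
  then obtain n where n: "(\<integral>x. s n x \<partial>M) < \<epsilon> / 2" by (meson eventually_sequentially order_refl)
  have sint: "integrable M (s n)"
    by (rule Bochner_Integration.integrable_bound[OF integrable_abs[OF f]]) (auto simp: s_def indicator_def)
  show thesis
  proof
    show "\<epsilon> / (2 * (real n + 1)) > 0" using \<open>\<epsilon> > 0\<close> by simp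
    fix E assume E[measurable]: "E \<in> sets M" and small: "emeasure M E < ennreal (\<epsilon> / (2 * (real n + 1)))"
    have fin: "emeasure M E < \<infinity>" by (rule order_less_trans[OF small]) simp
    have m: "measure M E < \<epsilon> / (2 * (real n + 1))"
      using small fin \<open>\<epsilon> > 0\<close> by (simp add: emeasure_eq_ennreal_measure ennreal_less_iff less_top)
    have "(LINT x:E|M. \<bar>f x\<bar>) \<le> (\<integral>x. real n * indicator E x + s n x \<partial>M)"
      unfolding set_lebesgue_integral_def
    proof (rule integral_mono)
      show "integrable M (\<lambda>x. real n * indicator E x + s n x)"
        using fin sint by (intro Bochner_Integration.integrable_add integrable_mult_right integrable_real_indicator) auto
      show "integrable M (\<lambda>x. indicat_real E x *\<^sub>R \<bar>f x\<bar>)"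
        by (rule Bochner_Integration.integrable_bound[OF integrable_abs[OF f]]) (auto simp: indicator_def)
    qed (auto simp: s_def indicator_def)
    also have "\<dots> = real n * measure M E + (\<integral>x. s n x \<partial>M)"
      using fin sint by (subst Bochner_Integration.integral_add)
        (auto intro!: integrable_mult_right integrable_real_indicator)
    also have "\<dots> < \<epsilon>"
    proof -
      have "real n * measure M E \<le> (real n + 1) * measure M E" by (simp add: mult_right_mono)
      also have "\<dots> < \<epsilon> / 2" using m by (simp add: field_simps)
      finally show ?thesis using n by simp
    qed
    finally show "(LINT x:E|M. \<bar>f x\<bar>) < \<epsilon>" .
  qed
qed

text \<open>
  Vitali's theorem covers the bad set, up to a null set, by disjoint balls on which the mean of \<open>f\<close> exceeds \<open>b\<close>.
  The balls may be chosen inside an open set \<open>U\<close> that is barely larger than \<open>F = {f < a}\<close>.  Then the integral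
  of \<open>f\<close> over their union is at least \<open>b\<close> times the measure of the union, but hardly more than \<open>a\<close> times that measure,
  since the part outside \<open>F\<close> is negligible for both the measure and the integral.  As \<open>a < b\<close>, the
  union has small measure.
\<close>

lemma negligible_large_averages:
  fixes f :: "'a::euclidean_space \<Rightarrow> real"
  assumes f: "integrable lebesgue f" and "a < b"
  shows "negligible {x. f x < a \<and> (\<forall>d>0. \<exists>r. 0 < r \<and> r < d \<and>
            b * measure lebesgue (ball x r) < (LINT y:ball x r|lebesgue. f y))}"
    (is "negligible ?E")
  unfolding negligible_outer_le
proof (intro allI impI)
  fix e :: real assume "e > 0"
  have fm[measurable]: "f \<in> borel_measurable lebesgue" using f by auto
  define F where "F = {x. f x < a}"
  have F: "F \<in> sets lebesgue" using borel_measurable_less[OF fm borel_measurable_const[of a]] by (simp add: F_def)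
  define \<epsilon> where "\<epsilon> = e * (b - a) / 2"
  have "\<epsilon> > 0" using \<open>e > 0\<close> \<open>a < b\<close> by (simp add: \<epsilon>_def)
  obtain \<delta> where "\<delta> > 0" and \<delta>: "\<And>E. \<lbrakk>E \<in> sets lebesgue; emeasure lebesgue E < ennreal \<delta>\<rbrakk> \<Longrightarrow> (LINT x:E|lebesgue. \<bar>f x\<bar>) < \<epsilon>"
    using integral_small_on_small_sets[OF f \<open>\<epsilon> > 0\<close>] by blast
  \<comment> \<open>Besides \<open>\<delta>\<close>, the second bound controls \<open>\<bar>a\<bar>\<close> times the measure of \<open>U - F\<close>: when \<open>a\<close> is negative, replacing the part of the balls inside \<open>F\<close> by the whole balls costs this much.\<close>
  define \<eta> where "\<eta> = min \<delta> (\<epsilon> / (\<bar>a\<bar> + 1))"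
  have "\<eta> > 0" using \<open>\<delta> > 0\<close> \<open>\<epsilon> > 0\<close> by (simp add: \<eta>_def)
  obtain U where U: "open U" "F \<subseteq> U" "U - F \<in> lmeasurable" "emeasure lebesgue (U - F) < ennreal \<eta>"
    using sets_lebesgue_outer_open[OF F \<open>\<eta> > 0\<close>] by blast
  have mUF: "measure lebesgue (U - F) < \<eta>"
    using U(3,4) \<open>\<eta> > 0\<close> by (simp add: emeasure_eq_measure2 ennreal_less_iff)
  let ?K = "{(x, r). 0 < r \<and> ball x r \<subseteq> U \<and> b * measure lebesgue (ball x r) < (LINT y:ball x r|lebesgue. f y)}"
  obtain C where C: "countable C" "C \<subseteq> ?K"
     "pairwise (\<lambda>i j. disjnt (ball (fst i) (snd i)) (ball (fst j) (snd j))) C"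
     "negligible (?E - (\<Union>i \<in> C. ball (fst i) (snd i)))"
  proof (rule Vitali_covering_theorem_balls[of ?E ?K fst snd])
    fix x and d :: real assume x: "x \<in> ?E" and "d > 0"
    then have "x \<in> U" using U(2) by (auto simp: F_def)
    then obtain k where k: "k > 0" "ball x k \<subseteq> U" using \<open>open U\<close> open_contains_ball by blast
    obtain r where r: "0 < r" "r < min d k" "b * measure lebesgue (ball x r) < (LINT y:ball x r|lebesgue. f y)"
      using x \<open>d > 0\<close> k(1) by (smt (verit) mem_Collect_eq)
    have "ball x r \<subseteq> U" using k(2) r(2) by (meson min_less_iff_conj less_imp_le subset_ball subset_trans)
    then show "\<exists>i. i \<in> ?K \<and> x \<in> ball (fst i) (snd i) \<and> snd i < d"
      using r by (intro exI[of _ "(x, r)"]) auto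
  qed
  let ?B = "\<lambda>i::'a \<times> real. ball (fst i) (snd i)"
  have bnd: "measure lebesgue (\<Union>i\<in>I. ?B i) \<le> e" if I: "I \<subseteq> C" "finite I" for I
  proof -
    let ?W = "\<Union>i\<in>I. ?B i"
    have WU: "?W \<subseteq> U" using I(1) C(2) by fastforce
    have Wm: "?W \<in> lmeasurable" using I(2) by (intro fmeasurable.finite_UN) auto
    have dj: "disjoint_family_on ?B I"
      using C(3) I(1) unfolding pairwise_def disjoint_family_on_def disjnt_def by blast
    have si: "set_integrable lebesgue X f" if "X \<in> sets lebesgue" for X
      using that f unfolding set_integrable_def by (rule integrable_mult_indicator)
    have "b * measure lebesgue ?W = (\<Sum>i\<in>I. b * measure lebesgue (?B i))"
      using dj I(2) using emeasure_bounded_finite[OF bounded_ball]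
      by (subst measure_finite_Union) (auto simp: sum_distrib_left less_top)
    also have "\<dots> \<le> (\<Sum>i\<in>I. (LINT y:?B i|lebesgue. f y))"
      using I(1) C(2) by (intro sum_mono less_imp_le) (auto simp: subset_iff split_beta)
    also have "\<dots> = (LINT y:?W|lebesgue. f y)"
      using dj I(2) by (intro set_integral_finite_Union[symmetric] si) auto
    also have "\<dots> \<le> (\<integral>y. a * indicator ?W y + (\<bar>a\<bar> * indicator (U - F) y + indicator (U - F) y * \<bar>f y\<bar>) \<partial>lebesgue)"
      unfolding set_lebesgue_integral_def
    proof (rule integral_mono)
      show "integrable lebesgue (\<lambda>y. indicat_real ?W y *\<^sub>R f y)"
        using si[of ?W] Wm unfolding set_integrable_def by (auto dest: fmeasurableD)
      have "integrable lebesgue (\<lambda>y. indicator (U - F) y *\<^sub>R \<bar>f y\<bar>)"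
        using U(3) f by (intro integrable_mult_indicator integrable_abs) (auto dest: fmeasurableD)
      then show "integrable lebesgue (\<lambda>y. a * indicator ?W y + (\<bar>a\<bar> * indicator (U - F) y + indicator (U - F) y * \<bar>f y\<bar>))"
        using Wm U(3) by (auto intro!: Bochner_Integration.integrable_add integrable_mult_right integrable_real_indicator simp: fmeasurable_def)
      fix y
      show "indicat_real ?W y *\<^sub>R f y \<le> a * indicator ?W y + (\<bar>a\<bar> * indicator (U - F) y + indicator (U - F) y * \<bar>f y\<bar>)"
      proof (cases "y \<in> ?W")
        case True
        then have "y \<in> U" using WU by blast
        then show ?thesis using True by (cases "y \<in> F") (auto simp: F_def indicator_def)
      next
        case False
        then show ?thesis by (simp add: indicator_def)
      qed
    qed
    also have "\<dots> = a * measure lebesgue ?W + (\<bar>a\<bar> * measure lebesgue (U - F) + (LINT y:U - F|lebesgue. \<bar>f y\<bar>))"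
    proof -
      have 1: "integrable lebesgue (\<lambda>y. indicator (U - F) y * \<bar>f y\<bar>)"
        using integrable_mult_indicator[OF fmeasurableD[OF U(3)] integrable_abs[OF f]] by simp
      have 2: "integrable lebesgue (\<lambda>y. a * indicator ?W y)" "integrable lebesgue (\<lambda>y. \<bar>a\<bar> * indicator (U - F) y)"
        using Wm U(3) by (auto intro!: integrable_mult_right integrable_real_indicator simp: fmeasurable_def)
      show ?thesis using 1 2 by (simp add: set_lebesgue_integral_def)
    qed
    also have "\<dots> \<le> a * measure lebesgue ?W + (\<epsilon> + \<epsilon>)"
    proof -
      have "\<bar>a\<bar> * measure lebesgue (U - F) \<le> (\<bar>a\<bar> + 1) * (\<epsilon> / (\<bar>a\<bar> + 1))"
        using mUF by (intro mult_mono) (auto simp: \<eta>_def)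
      also have "(\<bar>a\<bar> + 1) * (\<epsilon> / (\<bar>a\<bar> + 1)) = \<epsilon>" by simp
      finally have A: "\<bar>a\<bar> * measure lebesgue (U - F) \<le> \<epsilon>" .
      have "emeasure lebesgue (U - F) < ennreal \<delta>"
        using U(4) by (rule order_less_le_trans) (auto simp: \<eta>_def intro: ennreal_leI)
      then have "(LINT y:U - F|lebesgue. \<bar>f y\<bar>) \<le> \<epsilon>" using \<delta> U(3) by (auto dest: fmeasurableD intro: less_imp_le)
      then show ?thesis using A by linarith
    qed
    finally have "(b - a) * measure lebesgue ?W \<le> (b - a) * e" by (simp add: \<epsilon>_def algebra_simps)
    then show ?thesis using \<open>a < b\<close> by simp
  qed
  let ?W = "\<Union>i\<in>C. ?B i"
  have W: "?W \<in> lmeasurable" "measure lebesgue ?W \<le> e"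
    using fmeasurable_UN_bound[OF C(1) _ bnd] measure_UN_bound[OF C(1) _ bnd] by auto
  have N: "?E - ?W \<in> lmeasurable" "measure lebesgue (?E - ?W) = 0"
    using negligible_imp_measurable[OF C(4)] negligible_imp_measure0[OF C(4)] by blast+
  have "?W \<union> (?E - ?W) \<in> lmeasurable" using W(1) N(1) by (rule fmeasurable.Un)
  moreover have "measure lebesgue (?W \<union> (?E - ?W)) \<le> e"
    using measure_Un_le[OF fmeasurableD[OF W(1)] fmeasurableD[OF N(1)]] W(2) N(2) by linarith
  moreover have "?E \<subseteq> ?W \<union> (?E - ?W)" by blast
  ultimately show "\<exists>T. ?E \<subseteq> T \<and> T \<in> lmeasurable \<and> measure lebesgue T \<le> e" by (intro exI conjI)
qed

text \<open>
  Only countably many rational pairs \<open>a < b\<close> are needed to separate \<open>f x\<close> from any larger number \<open>c\<close>, so the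
  exceptional null sets can be united.
\<close>

lemma eventually_averages_less:
  fixes f :: "'a::euclidean_space \<Rightarrow> real"
  assumes f: "integrable lebesgue f"
  shows "AE x in lebesgue. \<forall>c>f x. eventually (\<lambda>r. (LINT y:ball x r|lebesgue. f y) / measure lebesgue (ball x r) < c) (at_right 0)"
proof -
  let ?P = "\<lambda>a b x. f x < a \<and> (\<forall>d>0. \<exists>r. 0 < r \<and> r < d \<and>
            b * measure lebesgue (ball x r) < (LINT y:ball x r|lebesgue. f y))"
  have "AE x in lebesgue. \<forall>p\<in>{(a,b). a < b \<and> a \<in> \<rat> \<and> b \<in> \<rat>}. \<not> ?P (fst p) (snd p) x"
  proof (subst AE_ball_countable)
    show "countable {(a,b). a < b \<and> a \<in> \<rat> \<and> b \<in> (\<rat>::real set)}"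
      by (rule countable_subset[OF _ countable_SIGMA[OF countable_rat countable_rat]]) auto
    show "\<forall>p\<in>{(a,b). a < b \<and> a \<in> \<rat> \<and> b \<in> \<rat>}. AE x in lebesgue. \<not> ?P (fst p) (snd p) x"
    proof clarify
      fix a b :: real assume "a < b"
      from negligible_large_averages[OF f this]
      have "{x. ?P a b x} \<in> null_sets lebesgue" by (simp add: negligible_iff_null_sets)
      then show "AE x in lebesgue. \<not> ?P (fst (a,b)) (snd (a,b)) x" by (rule AE_I') auto
    qed
  qed
  then show ?thesis
  proof eventually_elim
    fix x assume x: "\<forall>p\<in>{(a,b). a < b \<and> a \<in> \<rat> \<and> b \<in> \<rat>}. \<not> ?P (fst p) (snd p) x"
    show "\<forall>c>f x. eventually (\<lambda>r. (LINT y:ball x r|lebesgue. f y) / measure lebesgue (ball x r) < c) (at_right 0)"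
    proof (intro allI impI)
      fix c assume "f x < c"
      then obtain b where b: "b \<in> \<rat>" "f x < b" "b < c" using Rats_dense_in_real by blast
      then obtain a where a: "a \<in> \<rat>" "f x < a" "a < b" using Rats_dense_in_real by blast
      have "\<not> ?P a b x" using x a b by auto
      then obtain d where d: "d > 0"
        "\<And>r. \<lbrakk>0 < r; r < d\<rbrakk> \<Longrightarrow> (LINT y:ball x r|lebesgue. f y) \<le> b * measure lebesgue (ball x r)"
        using a(2) by (meson not_le)
      have "(LINT y:ball x r|lebesgue. f y) / measure lebesgue (ball x r) < c" if "0 < r" "r < d" for r
      proof -
        have "(LINT y:ball x r|lebesgue. f y) / measure lebesgue (ball x r) \<le> b"
          using d(2)[OF that] content_ball_pos[OF that(1), of x] by (simp add: divide_le_eq)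
        then show ?thesis using b by linarith
      qed
      then show "eventually (\<lambda>r. (LINT y:ball x r|lebesgue. f y) / measure lebesgue (ball x r) < c) (at_right 0)"
        using d(1) unfolding eventually_at_right_field by blast
    qed
  qed
qed

theorem lebesgue_differentiation:
  fixes f :: "'a::euclidean_space \<Rightarrow> real"
  assumes f: "integrable lebesgue f"
  shows "AE x in lebesgue. ((\<lambda>r. (LINT y:ball x r|lebesgue. f y) / measure lebesgue (ball x r)) \<longlongrightarrow> f x) (at_right 0)"
  using eventually_averages_less[OF f] eventually_averages_less[OF integrable_minus[OF f]]
proof eventually_elim
  fix x
  assume 1: "\<forall>c>f x. eventually (\<lambda>r. (LINT y:ball x r|lebesgue. f y) / measure lebesgue (ball x r) < c) (at_right 0)"
    and 2: "\<forall>c>- f x. eventually (\<lambda>r. (LINT y:ball x r|lebesgue. - f y) / measure lebesgue (ball x r) < c) (at_right 0)"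
  show "((\<lambda>r. (LINT y:ball x r|lebesgue. f y) / measure lebesgue (ball x r)) \<longlongrightarrow> f x) (at_right 0)"
  proof (rule order_tendstoI)
    fix c assume "c < f x"
    then have "- c > - f x" by simp
    from 2[rule_format, OF this]
    show "eventually (\<lambda>r. c < (LINT y:ball x r|lebesgue. f y) / measure lebesgue (ball x r)) (at_right 0)"
      by eventually_elim (simp add: set_lebesgue_integral_def)
  qed (use 1 in auto)
qed

section \<open>Minimising strongly convex functionals\<close>

lemma min_value_eqI:
  assumes "u \<in> X" "f u = ereal m" "\<And>v. v \<in> X \<Longrightarrow> ereal m \<le> f v"
  shows "min_value f X = m"
  unfolding min_value_def
proof (rule the_equality)
  show "(\<exists>u\<in>X. f u = ereal m) \<and> (\<forall>v\<in>X. ereal m \<le> f v)" using assms by blast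
  fix k assume k: "(\<exists>u\<in>X. f u = ereal k) \<and> (\<forall>v\<in>X. ereal k \<le> f v)"
  then obtain v where v: "v \<in> X" "f v = ereal k" by blast
  from k assms(1,2) have "ereal k \<le> ereal m" by metis
  moreover have "ereal m \<le> ereal k" using assms(3)[OF v(1)] v(2) by simp
  ultimately show "k = m" by simp
qed

text \<open>
  Read \<open>m\<close> as the minimum of a strongly convex function and \<open>b\<close> as its value at another point: comparing the minimum
  with the values on the segment joining the two points, dividing by \<open>t\<close> and letting \<open>t\<close> tend to 0 turns
  minimality into a quadratic gap.  It serves on the real line, where \<open>k\<close> is a multiple of the squared distance, and
  in the optimality condition, where \<open>k\<close> is the quadratic remainder of the cost.
\<close>

lemma growth_at_minimum:
  fixes m k b :: real
  assumes "\<And>t. \<lbrakk>0 < t; t < 1\<rbrakk> \<Longrightarrow> m + k * t * (1 - t) \<le> t * b + (1 - t) * m"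
  shows "m + k \<le> b"
proof -
  have "k \<le> b - m"
  proof (rule field_le_mult_one_interval)
    fix z :: real assume z: "0 < z" "z < 1"
    have "(1 - z) * (z * k) \<le> (1 - z) * (b - m)"
      using assms[of "1 - z"] z by (simp add: algebra_simps)
    then show "z * k \<le> b - m" using z by simp
  qed
  then show ?thesis by simp
qed

text \<open>
  The common core of the two existence proofs below; \<open>d\<close> is the squared distance, in one case of real
  numbers and in the other of controls in \<open>L\<^sup>2\<close>.  The midpoint of two almost minimal points cannot be lower
  than the infimum, so the points must be close.
\<close>

lemma minimizing_sequence:
  fixes f :: "'b \<Rightarrow> real" and d :: "'b \<Rightarrow> 'b \<Rightarrow> real" and \<epsilon> :: "nat \<Rightarrow> real"
  assumes "X \<noteq> {}" and below: "\<And>u. u \<in> X \<Longrightarrow> c \<le> f u"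
    and midpoint: "\<And>u v. \<lbrakk>u \<in> X; v \<in> X\<rbrakk> \<Longrightarrow> \<exists>w\<in>X. f w + d u v \<le> (f u + f v) / 2"
    and "\<And>n. \<epsilon> n > 0"
  shows "\<exists>u m. (\<forall>n. u n \<in> X) \<and> (\<forall>v\<in>X. m \<le> f v) \<and> (\<forall>n. f (u n) \<le> m + \<epsilon> n) \<and>
    (\<forall>n k. d (u n) (u k) \<le> max (\<epsilon> n) (\<epsilon> k))"
proof -
  define m where "m = (INF u\<in>X. f u)"
  have bdd: "bdd_below (f ` X)" using below by (intro bdd_belowI[of _ c]) auto
  have m: "m \<le> f v" if "v \<in> X" for v
    unfolding m_def using bdd that by (rule cINF_lower)
  have "\<exists>v\<in>X. f v < m + \<epsilon> n" for n
    using cINF_less_iff[OF \<open>X \<noteq> {}\<close> bdd, of "m + \<epsilon> n"] assms(4)[of n] by (simp add: m_def)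
  then obtain u where u: "\<And>n. u n \<in> X" "\<And>n. f (u n) < m + \<epsilon> n" by metis
  have "d (u n) (u k) \<le> max (\<epsilon> n) (\<epsilon> k)" for n k
  proof -
    obtain w where w: "w \<in> X" "f w + d (u n) (u k) \<le> (f (u n) + f (u k)) / 2"
      using midpoint[OF u(1) u(1)] by blast
    have "2 * d (u n) (u k) < \<epsilon> n + \<epsilon> k"
      using w(2) m[OF w(1)] u(2)[of n] u(2)[of k] by (simp add: field_simps)
    then show ?thesis by (simp add: max_def)
  qed
  then show ?thesis using u(1) m less_imp_le[OF u(2)] by blast
qed


section \<open>Pointwise minimisation of the integrand\<close>

locale strongly_convex_integrand =
  fixes g :: "real \<Rightarrow> ereal" and \<mu> :: real
  assumes lsc: "lower_semicontinuous g" and nonneg: "\<And>u. g u \<ge> 0"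
    and zero_iff: "\<And>u. g u = 0 \<longleftrightarrow> u = 0" and mu: "\<mu> > 0" and strongly_convex: "strongly_convex_fun \<mu> g"
begin

text \<open>
  Integrals and strong convexity are handled with real numbers.  Where \<open>g\<close> is infinite, \<open>gr\<close> has the default value 0, so
  comparisons between values of \<open>gr\<close> are restricted to the effective domain.
\<close>

abbreviation gr :: "real \<Rightarrow> real" where "gr u \<equiv> real_of_ereal (g u)"

lemma g_eq_gr: "u \<in> eff_dom g \<Longrightarrow> g u = ereal (gr u)"
  using nonneg[of u] by (cases "g u") (auto simp: eff_dom_def)

lemma g_le_iff: "u \<in> eff_dom g \<Longrightarrow> g u \<le> ereal c \<longleftrightarrow> gr u \<le> c"
  using g_eq_gr[of u] by (cases "g u") auto

lemma gr_nonneg: "gr u \<ge> 0"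
  using nonneg[of u] by (cases "g u") auto

lemma gr_0: "gr 0 = 0" and dom_0: "0 \<in> eff_dom g"
  using zero_iff[of 0] by (auto simp: eff_dom_def)

lemma domI: "g u \<le> ereal c \<Longrightarrow> u \<in> eff_dom g"
  by (cases "g u") (auto simp: eff_dom_def)

lemma strongly_convex_gr:
  assumes "u \<in> eff_dom g" "v \<in> eff_dom g" "0 < t" "t < 1"
  shows "t * u + (1 - t) * v \<in> eff_dom g"
    and "\<mu> / 2 * t * (1 - t) * (u - v)\<^sup>2 + gr (t * u + (1 - t) * v) \<le> t * gr u + (1 - t) * gr v"
proof -
  have *: "ereal (\<mu> / 2 * t * (1 - t) * (u - v)\<^sup>2) + g (t * u + (1 - t) * v)
          \<le> ereal (t * gr u + (1 - t) * gr v)"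
    using strongly_convex[unfolded strongly_convex_fun_def, rule_format, OF assms(1,2), of t] assms(3,4)
    using g_eq_gr[OF assms(1)] g_eq_gr[OF assms(2)] by (cases "g u"; cases "g v") simp_all
  then show d: "t * u + (1 - t) * v \<in> eff_dom g"
    by (cases "g (t * u + (1 - t) * v)") (auto simp: eff_dom_def)
  from * show "\<mu> / 2 * t * (1 - t) * (u - v)\<^sup>2 + gr (t * u + (1 - t) * v) \<le> t * gr u + (1 - t) * gr v"
    using g_eq_gr[OF d] by (cases "g (t * u + (1 - t) * v)") simp_all
qed

lemma gr_ge_square: 
  assumes "u \<in> eff_dom g" shows "\<mu> / 2 * u\<^sup>2 \<le> gr u"
proof -
  have "0 + \<mu> / 2 * u\<^sup>2 \<le> gr u"
  proof (rule growth_at_minimum)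
    fix t :: real assume t: "0 < t" "t < 1"
    show "0 + \<mu> / 2 * u\<^sup>2 * t * (1 - t) \<le> t * gr u + (1 - t) * 0"
      using strongly_convex_gr(2)[OF assms dom_0 t] gr_nonneg[of "t * u + (1 - t) * 0"] 
      by (simp add: gr_0 mult_ac)
  qed
  then show ?thesis by simp
qed

lemma lsc_sequentially:
  assumes "x \<longlonglongrightarrow> u" shows "g u \<le> liminf (\<lambda>n. g (x n))"
  unfolding le_Liminf_iff
proof (intro allI impI)
  fix y assume y: "y < g u"
  have "eventually (\<lambda>v. y < g v) (at u)"
    using lsc y unfolding lower_semicontinuous_def le_Liminf_iff by blast
  then have "eventually (\<lambda>v. y < g v) (nhds u)" using y by (simp add: eventually_nhds_conv_at)
  then show "eventually (\<lambda>n. y < g (x n)) sequentially" using assms by (rule eventually_compose_filterlim)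
qed

lemma g_measurable [measurable]: "g \<in> borel_measurable borel"
proof (rule borel_measurableI_greater)
  fix y
  have "open {u. y < g u}"
    unfolding open_subopen[of "{u. y < g u}"]
  proof clarify
    fix u assume y: "y < g u"
    have "eventually (\<lambda>v. y < g v) (at u)"
      using lsc y unfolding lower_semicontinuous_def le_Liminf_iff by blast
    then have "eventually (\<lambda>v. y < g v) (nhds u)" using y by (simp add: eventually_nhds_conv_at)
    then show "\<exists>T. open T \<and> u \<in> T \<and> T \<subseteq> {u. y < g u}" unfolding eventually_nhds by blast
  qed
  then show "{x \<in> space borel. y < g x} \<in> sets borel" by simp
qed

text \<open>
  A minimising sequence is Cauchy by strong convexity, and lower semicontinuity passes to its limit.  The lower bound that
  starts the argument completes the square in \<open>p * v + \<mu>/2 * v\<^sup>2\<close>.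
\<close>

lemma pointwise_min_exists: "\<exists>u\<in>eff_dom g. \<forall>v\<in>eff_dom g. p * u + gr u \<le> p * v + gr v"
proof -
  let ?f = "\<lambda>v. p * v + gr v"
  have below: "- p\<^sup>2 / (2 * \<mu>) \<le> ?f u" if "u \<in> eff_dom g" for u
  proof -
    have "0 \<le> (\<mu> * u + p)\<^sup>2 / (2 * \<mu>)" using mu by simp
    also have "\<dots> = \<mu> / 2 * u\<^sup>2 + p * u + p\<^sup>2 / (2 * \<mu>)"
      using mu by (simp add: power2_eq_square field_simps)
    finally show ?thesis using gr_ge_square[OF that] by simp
  qed
  have mid: "\<exists>w\<in>eff_dom g. ?f w + \<mu> / 8 * (u - v)\<^sup>2 \<le> (?f u + ?f v) / 2"
    if "u \<in> eff_dom g" "v \<in> eff_dom g" for u v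
  proof
    note z = strongly_convex_gr[OF that, of "1/2"]
    show "1/2 * u + (1 - 1/2) * v \<in> eff_dom g" by (rule z(1)) simp_all
    have "\<mu> / 2 * (1/2) * (1 - 1/2) * (u - v)\<^sup>2 + gr (1/2 * u + (1 - 1/2) * v) \<le> 1/2 * gr u + (1 - 1/2) * gr v"
      by (rule z(2)) simp_all
    moreover have "p * (1/2 * u + (1 - 1/2) * v) = (p * u + p * v) / 2" by (simp add: algebra_simps)
    ultimately show "?f (1/2 * u + (1 - 1/2) * v) + \<mu> / 8 * (u - v)\<^sup>2 \<le> (?f u + ?f v) / 2"
      by simp
  qed
  have ne: "eff_dom g \<noteq> {}" using dom_0 by blast
  have pos: "inverse (real (Suc n)) > 0" for n by simp
  obtain x m where x: "\<And>n. x n \<in> eff_dom g" "\<And>v. v \<in> eff_dom g \<Longrightarrow> m \<le> ?f v"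
     "\<And>n. ?f (x n) \<le> m + inverse (real (Suc n))"
    "\<And>n k. \<mu> / 8 * (x n - x k)\<^sup>2 \<le> max (inverse (real (Suc n))) (inverse (real (Suc k)))"
    using minimizing_sequence[where d = "\<lambda>u v. \<mu> / 8 * (u - v)\<^sup>2"
        and \<epsilon> = "\<lambda>n. inverse (real (Suc n))", OF ne below mid pos] by blast
  have "Cauchy x"
  proof (rule CauchyI)
    fix e :: real assume "e > 0"
    then have "\<mu> / 8 * e\<^sup>2 > 0" using mu by simp
    then obtain N where N: "inverse (real (Suc N)) < \<mu> / 8 * e\<^sup>2" using reals_Archimedean by blast
    show "\<exists>M. \<forall>m\<ge>M. \<forall>n\<ge>M. norm (x m - x n) < e"
    proof (intro exI[of _ N] allI impI)
      fix i j assume ij: "N \<le> i" "N \<le> j"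
      have "\<mu> / 8 * (x i - x j)\<^sup>2 \<le> max (inverse (real (Suc i))) (inverse (real (Suc j)))" by (rule x(4))
      also have "\<dots> \<le> inverse (real (Suc N))" using ij by (intro max.boundedI le_imp_inverse_le) auto
      also have "\<dots> < \<mu> / 8 * e\<^sup>2" by (rule N)
      finally have "\<mu> / 8 * (x i - x j)\<^sup>2 < \<mu> / 8 * e\<^sup>2" .
      then have "\<bar>x i - x j\<bar>\<^sup>2 < e\<^sup>2" using mu by simp
      then show "norm (x i - x j) < e" using power_less_imp_less_base[of "\<bar>x i - x j\<bar>" 2 e] \<open>e > 0\<close> by simp
    qed
  qed
  then obtain u where u: "x \<longlonglongrightarrow> u" using Cauchy_convergent_iff convergent_def by blast
  have "g u \<le> liminf (\<lambda>n. g (x n))" using lsc_sequentially[OF u] .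
  also have "\<dots> \<le> liminf (\<lambda>n. ereal (m + inverse (real (Suc n)) - p * x n))"
    using x(3) by (intro Liminf_mono always_eventually allI) (simp add: g_le_iff[OF x(1)] algebra_simps)
  also have "\<dots> = ereal (m + 0 - p * u)"
    by (intro lim_imp_Liminf tendsto_ereal tendsto_intros u LIMSEQ_inverse_real_of_nat) simp
  finally have le: "g u \<le> ereal (m - p * u)" by simp
  have d: "u \<in> eff_dom g" using le by (rule domI)
  have "?f u \<le> m" using le by (simp add: g_le_iff[OF d])
  then show ?thesis using d x(2) by (intro bexI[of _ u]) (auto intro: order_trans)
qed

definition pointwise_min :: "real \<Rightarrow> real" where
  "pointwise_min p = (SOME u. u \<in> eff_dom g \<and> (\<forall>v\<in>eff_dom g. p * u + gr u \<le> p * v + gr v))"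

lemma pointwise_min_dom: "pointwise_min p \<in> eff_dom g"
  and pointwise_min_le: "v \<in> eff_dom g \<Longrightarrow> p * pointwise_min p + gr (pointwise_min p) \<le> p * v + gr v"
  using someI_ex[OF pointwise_min_exists[of p, unfolded Bex_def]] unfolding pointwise_min_def by blast+

lemma pointwise_min_growth:
  assumes v: "v \<in> eff_dom g"
  shows "p * pointwise_min p + gr (pointwise_min p) + \<mu> / 2 * (v - pointwise_min p)\<^sup>2 \<le> p * v + gr v"
proof (rule growth_at_minimum)
  fix t :: real assume t: "0 < t" "t < 1"
  let ?w = "pointwise_min p" let ?z = "t * v + (1 - t) * ?w"
  note z = strongly_convex_gr[OF v pointwise_min_dom[of p] t]
  have "p * ?w + gr ?w \<le> p * ?z + gr ?z" by (rule pointwise_min_le[OF z(1)])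
  with z(2) show "p * ?w + gr ?w + \<mu> / 2 * (v - ?w)\<^sup>2 * t * (1 - t) \<le> t * (p * v + gr v) + (1 - t) * (p * ?w + gr ?w)"
    by (simp add: algebra_simps)
qed

text \<open>
  Add the growth inequality at the minimiser for \<open>p\<close>, tested with the minimiser for \<open>p'\<close>, to the one with the roles
  exchanged: the values of \<open>g\<close> cancel.  Continuity is what makes the pointwise minimisers measurable, and the
  comparison with \<open>p' = 0\<close> puts them into \<open>L\<^sup>2\<close>.
\<close>

lemma pointwise_min_lipschitz: "\<bar>pointwise_min p - pointwise_min p'\<bar> \<le> \<bar>p - p'\<bar> / \<mu>"
proof -
  let ?a = "pointwise_min p" and ?b = "pointwise_min p'"
  have "\<mu> * \<bar>?a - ?b\<bar>\<^sup>2 \<le> (p - p') * (?b - ?a)"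
    using pointwise_min_growth[OF pointwise_min_dom[of p'], of p] pointwise_min_growth[OF pointwise_min_dom[of p], of p']
    by (simp add: power2_eq_square algebra_simps)
  also have "\<dots> \<le> \<bar>p - p'\<bar> * \<bar>?a - ?b\<bar>" using abs_ge_self[of "(p - p') * (?b - ?a)"] by (simp add: abs_mult abs_minus_commute)
  finally have "\<mu> * \<bar>?a - ?b\<bar> \<le> \<bar>p - p'\<bar>" 
    using mult_right_le_imp_le[of "\<mu> * \<bar>?a - ?b\<bar>" "\<bar>?a - ?b\<bar>" "\<bar>p - p'\<bar>"]
    by (cases "?a = ?b") (simp_all add: power2_eq_square mult.assoc)
  then show ?thesis using mu by (simp add: field_simps)
qed

lemma pointwise_min_0: "pointwise_min 0 = 0"
proof -
  have "\<mu> / 2 * (pointwise_min 0)\<^sup>2 \<le> 0"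
    using pointwise_min_growth[OF dom_0, of 0] gr_nonneg[of "pointwise_min 0"] by (simp add: gr_0)
  then show ?thesis using mu by (simp add: mult_le_0_iff)
qed

lemma abs_pointwise_min_le: "\<bar>pointwise_min p\<bar> \<le> \<bar>p\<bar> / \<mu>"
  using pointwise_min_lipschitz[of p 0] by (simp add: pointwise_min_0)

lemma pointwise_min_measurable [measurable]: "pointwise_min \<in> borel_measurable borel"
proof -
  have "(1 / \<mu>)-lipschitz_on UNIV pointwise_min"
    using pointwise_min_lipschitz mu by (intro lipschitz_onI) (auto simp: dist_real_def)
  then show ?thesis by (intro borel_measurable_continuous_onI lipschitz_on_continuous_on)
qed

lemma H_bar_eq: "H_bar g p = p * pointwise_min p + gr (pointwise_min p)"
  unfolding H_bar_def
proof (rule min_value_eqI[of "pointwise_min p"])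
  show "ereal (p * pointwise_min p) + g (pointwise_min p) = ereal (p * pointwise_min p + gr (pointwise_min p))"
    by (subst g_eq_gr[OF pointwise_min_dom]) simp
  fix v show "ereal (p * pointwise_min p + gr (pointwise_min p)) \<le> ereal (p * v) + g v"
  proof (cases "v \<in> eff_dom g")
    case True then show ?thesis
      using pointwise_min_le[OF True, of p] g_eq_gr[OF True] by (cases "g v") simp_all
  next
    case False then show ?thesis by (simp add: eff_dom_def)
  qed
qed simp

lemma H_bar_le: "v \<in> eff_dom g \<Longrightarrow> H_bar g p \<le> p * v + gr v"
  using pointwise_min_le by (simp add: H_bar_eq)

lemma H_bar_measurable [measurable]: "H_bar g \<in> borel_measurable borel"
  unfolding H_bar_eq[abs_def] by measurable

lemma abs_H_bar_le: "\<bar>H_bar g p\<bar> \<le> p\<^sup>2 / \<mu>"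
proof -
  have "H_bar g p \<le> 0" using H_bar_le[OF dom_0, of p] by (simp add: gr_0)
  moreover have "- (p\<^sup>2 / \<mu>) \<le> H_bar g p"
  proof -
    have "\<bar>p * pointwise_min p\<bar> \<le> \<bar>p\<bar> * (\<bar>p\<bar> / \<mu>)"
      unfolding abs_mult using abs_pointwise_min_le by (intro mult_left_mono) auto
    also have "\<dots> = p\<^sup>2 / \<mu>" by (simp add: power2_eq_square)
    finally show ?thesis using gr_nonneg[of "pointwise_min p"] unfolding H_bar_eq by linarith
  qed
  ultimately show ?thesis by simp
qed

end

section \<open>Square-integrable functions\<close>

lemma Lp_2_iff: "u \<in> Lp M 2 \<longleftrightarrow> u \<in> borel_measurable M \<and> integrable M (\<lambda>x. (u x)\<^sup>2)"
  by (simp add: Lp_def powr_numeral)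

lemma Lp_norm_2_square: "(Lp_norm M 2 u)\<^sup>2 = (\<integral>x. (u x)\<^sup>2 \<partial>M)"
  by (simp add: Lp_norm_def powr_numeral powr_half_sqrt)

lemma Lp_2_measurable: "u \<in> Lp M 2 \<Longrightarrow> u \<in> borel_measurable M"
  and Lp_2_integrable_square: "u \<in> Lp M 2 \<Longrightarrow> integrable M (\<lambda>x. (u x)\<^sup>2)"
  by (simp_all add: Lp_2_iff)

lemma Lp_2_dominated:
  assumes v: "v \<in> Lp M 2" and u: "u \<in> borel_measurable M" and le: "\<And>x. \<bar>u x\<bar> \<le> c * \<bar>v x\<bar>"
  shows "u \<in> Lp M 2"
proof -
  have "(u x)\<^sup>2 \<le> c\<^sup>2 * (v x)\<^sup>2" for x
    using power_mono[OF le[of x], of 2] by (simp add: power_mult_distrib)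
  then have "integrable M (\<lambda>x. (u x)\<^sup>2)"
    using u by (intro Bochner_Integration.integrable_bound[OF integrable_mult_right[OF Lp_2_integrable_square[OF v], of "c\<^sup>2"]]) auto
  then show ?thesis using u by (simp add: Lp_2_iff)
qed

lemma Lp_2_integrable_mult:
  assumes u: "u \<in> Lp M 2" and v: "v \<in> Lp M 2"
  shows "integrable M (\<lambda>x. u x * v x)"
proof (rule Bochner_Integration.integrable_bound)
  show "integrable M (\<lambda>x. (u x)\<^sup>2 + (v x)\<^sup>2)"
    using assms by (intro Bochner_Integration.integrable_add Lp_2_integrable_square)
  show "(\<lambda>x. u x * v x) \<in> borel_measurable M"
    using assms by (intro borel_measurable_times Lp_2_measurable)
  have "\<bar>a * b\<bar> \<le> a\<^sup>2 + b\<^sup>2" for a b :: real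
  proof -
    have "2 * \<bar>a * b\<bar> \<le> a\<^sup>2 + b\<^sup>2"
      using sum_squares_bound[of "\<bar>a\<bar>" "\<bar>b\<bar>"] by (simp add: abs_mult)
    then show ?thesis using abs_ge_zero[of "a * b"] by linarith
  qed
  then show "AE x in M. norm (u x * v x) \<le> norm ((u x)\<^sup>2 + (v x)\<^sup>2)" by simp
qed

lemma Lp_2_add:
  assumes u: "u \<in> Lp M 2" and v: "v \<in> Lp M 2"
  shows "(\<lambda>x. u x + v x) \<in> Lp M 2"
proof -
  have "integrable M (\<lambda>x. (u x)\<^sup>2 + 2 * (u x * v x) + (v x)\<^sup>2)"
    using assms by (intro Bochner_Integration.integrable_add integrable_mult_right Lp_2_integrable_square Lp_2_integrable_mult)
  then show ?thesis using assms by (auto simp: Lp_2_iff power2_sum algebra_simps)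
qed

lemma Lp_2_scale:
  assumes u: "u \<in> Lp M 2" shows "(\<lambda>x. c * u x) \<in> Lp M 2"
  using assms by (auto simp: Lp_2_iff power_mult_distrib)

lemma Lp_2_diff:
  assumes u: "u \<in> Lp M 2" and v: "v \<in> Lp M 2"
  shows "(\<lambda>x. u x - v x) \<in> Lp M 2"
  using Lp_2_add[OF u Lp_2_scale[OF v, of "-1"]] by simp

lemma Lp_2_zero: "(\<lambda>x. 0) \<in> Lp M 2"
  by (simp add: Lp_2_iff)

text \<open>
  Completeness of \<open>L\<^sup>2\<close> for a rapidly converging sequence.  The increments are integrable with summable integrals, because
  \<open>\<bar>d\<bar> \<le> (1/2)\<^sup>n + 2\<^sup>n d\<^sup>2\<close> and the measure is finite, so the telescoping sum converges almost everywhere.  The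
  convergence in norm then follows from Fatou's lemma.
\<close>

lemma Lp_2_limit:
  fixes u :: "nat \<Rightarrow> 'a \<Rightarrow> real"
  assumes "finite_measure M" and u: "\<And>n. u n \<in> Lp M 2"
    and bound: "\<And>n k. (\<integral>x. (u n x - u k x)\<^sup>2 \<partial>M) \<le> K * max ((1/4) ^ n) ((1/4) ^ k)"
  shows "\<exists>v\<in>Lp M 2. (AE x in M. (\<lambda>n. u n x) \<longlonglongrightarrow> v x) \<and> (\<lambda>n. \<integral>x. (u n x - v x)\<^sup>2 \<partial>M) \<longlonglongrightarrow> 0"
proof -
  interpret finite_measure M by fact
  have [measurable]: "u n \<in> borel_measurable M" for n using u by (rule Lp_2_measurable)
  have sq: "integrable M (\<lambda>x. (u n x - u k x)\<^sup>2)" for n k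
    using Lp_2_diff[OF u u] by (rule Lp_2_integrable_square)
  have K: "0 \<le> K"
  proof -
    have "0 \<le> (\<integral>x. (u 0 x - u 0 x)\<^sup>2 \<partial>M)" by simp
    also have "\<dots> \<le> K * max ((1/4) ^ 0) ((1/4) ^ 0)" by (rule bound)
    finally show ?thesis by simp
  qed
  define d where "d = (\<lambda>n x. \<bar>u (Suc n) x - u n x\<bar>)"
  have [measurable]: "d n \<in> borel_measurable M" for n unfolding d_def by measurable
  have d_le: "d n x \<le> (1/2) ^ n + 2 ^ n * (u (Suc n) x - u n x)\<^sup>2" for n x
  proof -
    \<comment> \<open>Young's inequality with the weight \<open>2\<^sup>n\<close>, which balances \<open>d\<^sup>2 \<approx> 4\<^sup>-\<^sup>n\<close> against \<open>2\<^sup>-\<^sup>n\<close>.\<close>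
    have "0 \<le> (1 / 2 - 2 ^ n * d n x)\<^sup>2" by simp
    then have "d n x \<le> 1 / 4 * (1/2) ^ n + 2 ^ n * (d n x)\<^sup>2"
      by (simp add: power2_eq_square field_simps)
    moreover have "1 / 4 * (1/2) ^ n \<le> (1/2::real) ^ n" by simp
    ultimately show ?thesis unfolding d_def power2_abs by linarith
  qed
  have dint: "(\<integral>\<^sup>+x. ennreal (d n x) \<partial>M) \<le> ennreal ((measure M (space M) + K) * (1/2) ^ n)" for n
  proof -
    have i: "integrable M (\<lambda>x. (1/2) ^ n + 2 ^ n * (u (Suc n) x - u n x)\<^sup>2)"
      using sq by (intro Bochner_Integration.integrable_add integrable_mult_right) auto
    have "(\<integral>\<^sup>+x. ennreal (d n x) \<partial>M) \<le> (\<integral>\<^sup>+x. ennreal ((1/2) ^ n + 2 ^ n * (u (Suc n) x - u n x)\<^sup>2) \<partial>M)"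
      using d_le by (intro nn_integral_mono ennreal_leI)
    also have "\<dots> = ennreal (\<integral>x. (1/2) ^ n + 2 ^ n * (u (Suc n) x - u n x)\<^sup>2 \<partial>M)"
      by (intro nn_integral_eq_integral i) auto
    also have "(\<integral>x. (1/2) ^ n + 2 ^ n * (u (Suc n) x - u n x)\<^sup>2 \<partial>M)
        = measure M (space M) * (1/2) ^ n + 2 ^ n * (\<integral>x. (u (Suc n) x - u n x)\<^sup>2 \<partial>M)"
      using sq by (subst Bochner_Integration.integral_add) auto
    also have "\<dots> \<le> measure M (space M) * (1/2) ^ n + 2 ^ n * (K * (1/4) ^ n)"
      using bound[of "Suc n" n] K by (intro add_left_mono mult_left_mono) (auto simp: max_def)
    also have "\<dots> = (measure M (space M) + K) * (1/2) ^ n"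
    proof -
      have "2 ^ n * (1/4) ^ n = (1/2 :: real) ^ n" by (simp flip: power_mult_distrib)
      then show ?thesis by (simp add: algebra_simps)
    qed
    finally show ?thesis by (simp add: ennreal_leI)
  qed
  have "(\<integral>\<^sup>+x. (\<Sum>n. ennreal (d n x)) \<partial>M) = (\<Sum>n. \<integral>\<^sup>+x. ennreal (d n x) \<partial>M)"
    by (rule nn_integral_suminf) measurable
  also have "\<dots> \<le> (\<Sum>n. ennreal ((measure M (space M) + K) * (1/2) ^ n))"
    by (intro suminf_le dint) auto
  also have "\<dots> = ennreal (\<Sum>n. (measure M (space M) + K) * (1/2) ^ n)"
    using K by (intro suminf_ennreal2 summable_mult summable_geometric) auto
  finally have "(\<integral>\<^sup>+x. (\<Sum>n. ennreal (d n x)) \<partial>M) \<noteq> \<infinity>"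
    by (auto simp: top_unique)
  then have "AE x in M. (\<Sum>n. ennreal (d n x)) \<noteq> \<infinity>"
    by (intro nn_integral_PInf_AE) auto
  then have conv: "AE x in M. convergent (\<lambda>n. u n x)"
  proof eventually_elim
    fix x assume "(\<Sum>n. ennreal (d n x)) \<noteq> \<infinity>"
    then have "summable (\<lambda>n. d n x)"
      by (intro summable_suminf_not_top) (auto simp: d_def)
    then have "summable (\<lambda>n. u (Suc n) x - u n x)"
      unfolding d_def real_norm_def[symmetric] by (rule summable_norm_cancel)
    then have "(\<lambda>n. \<Sum>k<n. u (Suc k) x - u k x) \<longlonglongrightarrow> (\<Sum>k. u (Suc k) x - u k x)"
      by (rule summable_LIMSEQ)
    then have "(\<lambda>n. u n x - u 0 x) \<longlonglongrightarrow> (\<Sum>k. u (Suc k) x - u k x)"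
      by (simp add: sum_lessThan_telescope[of "\<lambda>k. u k x"])
    then have "(\<lambda>n. (u n x - u 0 x) + u 0 x) \<longlonglongrightarrow> (\<Sum>k. u (Suc k) x - u k x) + u 0 x"
      by (intro tendsto_intros)
    then show "convergent (\<lambda>n. u n x)" by (auto simp: convergent_def)
  qed
  define v where "v = (\<lambda>x. lim (\<lambda>n. u n x))"
  have vm[measurable]: "v \<in> borel_measurable M"
    unfolding v_def by (rule borel_measurable_lim_metric) measurable
  have lim: "AE x in M. (\<lambda>n. u n x) \<longlonglongrightarrow> v x"
    using conv by eventually_elim (simp add: v_def convergent_LIMSEQ_iff)
  have fatou: "(\<integral>\<^sup>+x. ennreal ((u n x - v x)\<^sup>2) \<partial>M) \<le> ennreal (K * (1/4) ^ n)" for n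
  proof -
    have "(\<integral>\<^sup>+x. ennreal ((u n x - v x)\<^sup>2) \<partial>M) = (\<integral>\<^sup>+x. liminf (\<lambda>k. ennreal ((u n x - u k x)\<^sup>2)) \<partial>M)"
    proof (rule nn_integral_cong_AE)
      show "AE x in M. ennreal ((u n x - v x)\<^sup>2) = liminf (\<lambda>k. ennreal ((u n x - u k x)\<^sup>2))"
        using lim
      proof eventually_elim
        fix x assume "(\<lambda>n. u n x) \<longlonglongrightarrow> v x"
        then have "(\<lambda>k. ennreal ((u n x - u k x)\<^sup>2)) \<longlonglongrightarrow> ennreal ((u n x - v x)\<^sup>2)"
          by (intro tendsto_ennrealI tendsto_intros)
        then show "ennreal ((u n x - v x)\<^sup>2) = liminf (\<lambda>k. ennreal ((u n x - u k x)\<^sup>2))"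
          by (intro lim_imp_Liminf[symmetric]) auto
      qed
    qed
    also have "\<dots> \<le> liminf (\<lambda>k. \<integral>\<^sup>+x. ennreal ((u n x - u k x)\<^sup>2) \<partial>M)"
      by (rule nn_integral_liminf) measurable
    also have "\<dots> \<le> ennreal (K * (1/4) ^ n)"
    proof (rule Liminf_le)
      show "eventually (\<lambda>k. (\<integral>\<^sup>+x. ennreal ((u n x - u k x)\<^sup>2) \<partial>M) \<le> ennreal (K * (1/4) ^ n)) sequentially"
        using eventually_ge_at_top[of n]
      proof eventually_elim
        fix k assume "n \<le> k"
        then have "max ((1/4) ^ n) ((1/4) ^ k) = (1/4::real) ^ n"
          by (simp add: max_def power_decreasing_iff)
        then have "(\<integral>x. (u n x - u k x)\<^sup>2 \<partial>M) \<le> K * (1/4) ^ n" using bound[of n k] by simp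
        then show "(\<integral>\<^sup>+x. ennreal ((u n x - u k x)\<^sup>2) \<partial>M) \<le> ennreal (K * (1/4) ^ n)"
          by (subst nn_integral_eq_integral[OF sq]) (auto intro: ennreal_leI)
      qed
    qed simp
    finally show ?thesis .
  qed
  have int: "integrable M (\<lambda>x. (u n x - v x)\<^sup>2)" for n
    using fatou[of n] by (intro integrableI_nonneg) (auto simp: less_top[symmetric] top_unique)
  have le: "(\<integral>x. (u n x - v x)\<^sup>2 \<partial>M) \<le> K * (1/4) ^ n" for n
    using fatou[of n] K by (subst (asm) nn_integral_eq_integral[OF int]) auto
  have "(\<lambda>x. u 0 x - v x) \<in> Lp M 2" using int by (simp add: Lp_2_iff)
  from Lp_2_diff[OF u[of 0] this] have v: "v \<in> Lp M 2" by simp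
  have "(\<lambda>n. \<integral>x. (u n x - v x)\<^sup>2 \<partial>M) \<longlonglongrightarrow> 0"
  proof (rule tendsto_sandwich[where f = "\<lambda>_. 0" and h = "\<lambda>n. K * (1/4) ^ n"])
    show "(\<lambda>n. K * (1/4) ^ n) \<longlonglongrightarrow> 0"
      by (intro tendsto_mult_right_zero LIMSEQ_realpow_zero) auto
  qed (use le in auto)
  then show ?thesis using v lim by blast
qed

section \<open>The cost functional and its minimisers\<close>

lemma indicator_lebesgue_on [measurable]:
  "A \<in> sets lebesgue \<Longrightarrow> (indicator A :: 'a::euclidean_space \<Rightarrow> real) \<in> borel_measurable (lebesgue_on \<Omega>)"
  by (intro measurable_restrict_space1 borel_measurable_indicator)

lemma integrable_indicator_mult:
  assumes "A \<in> sets lebesgue" "integrable (lebesgue_on \<Omega>) f"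
  shows "integrable (lebesgue_on \<Omega>) (\<lambda>x. indicator A x * (f x :: real))"
proof (rule Bochner_Integration.integrable_bound[OF assms(2)])
  show "(\<lambda>x. indicator A x * f x) \<in> borel_measurable (lebesgue_on \<Omega>)"
    using assms by (intro borel_measurable_times indicator_lebesgue_on) auto
qed (auto simp: indicator_def)

lemma Lp_2_indicator_mult:
  assumes "A \<in> sets lebesgue" "u \<in> Lp (lebesgue_on \<Omega>) 2"
  shows "(\<lambda>x. indicator A x * u x) \<in> Lp (lebesgue_on \<Omega>) 2"
proof (rule Lp_2_dominated[OF assms(2), of _ 1])
  show "(\<lambda>x. indicator A x * u x) \<in> borel_measurable (lebesgue_on \<Omega>)"
    using assms by (intro borel_measurable_times indicator_lebesgue_on) (auto dest: Lp_2_measurable)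
qed (auto simp: indicator_def)

lemma ext_integral_eq_integral:
  assumes "integrable M h" "AE x in M. f x = ereal (h x)"
  shows "ext_integral M f = ereal (\<integral>x. h x \<partial>M)"
proof -
  have fin: "(\<integral>\<^sup>+x. ennreal (h x) \<partial>M) \<noteq> \<infinity>" "(\<integral>\<^sup>+x. ennreal (- h x) \<partial>M) \<noteq> \<infinity>"
    using assms(1) unfolding real_integrable_def by auto
  have 1: "(\<integral>\<^sup>+x. e2ennreal (f x) \<partial>M) = (\<integral>\<^sup>+x. ennreal (h x) \<partial>M)"
    using assms(2) by (intro nn_integral_cong_AE) (auto simp: e2ennreal_ereal)
  have 2: "(\<integral>\<^sup>+x. e2ennreal (- f x) \<partial>M) = (\<integral>\<^sup>+x. ennreal (- h x) \<partial>M)"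
    using assms(2) by (intro nn_integral_cong_AE) (auto simp: e2ennreal_ereal)
  have 3: "enn2ereal a = ereal (enn2real a)" if "a \<noteq> \<infinity>" for a
    using that by (cases a) auto
  show ?thesis
    unfolding ext_integral_def 1 2 3[OF fin(1)] 3[OF fin(2)] real_lebesgue_integral_def[OF assms(1)] by simp
qed

locale control_problem = strongly_convex_integrand g \<mu> for g \<mu> +
  fixes \<Omega> :: "'a::euclidean_space set" and S :: "('a \<Rightarrow> real) \<Rightarrow> 'y::real_inner"
    and Sadj :: "'y \<Rightarrow> 'a \<Rightarrow> real" and yd :: 'y and \<beta> :: "'a \<Rightarrow> real"
  assumes \<Omega>_sets: "\<Omega> \<in> sets lebesgue" and \<Omega>_finite: "emeasure lebesgue \<Omega> < \<infinity>"
    and S_bounded_linear: "bounded_linear_on_Lp (lebesgue_on \<Omega>) 2 S"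
    and S_adjoint: "is_L2_adjoint (lebesgue_on \<Omega>) S Sadj"
    and \<beta>_integrable: "integrable (lebesgue_on \<Omega>) \<beta>"
begin

abbreviation M :: "'a measure" where "M \<equiv> lebesgue_on \<Omega>"
abbreviation L2 :: "('a \<Rightarrow> real) set" where "L2 \<equiv> Lp M 2"

sublocale finite_measure M
  using \<Omega>_sets \<Omega>_finite by (intro finite_measureI) (simp add: emeasure_restrict_space)

lemma S_add: "u \<in> L2 \<Longrightarrow> v \<in> L2 \<Longrightarrow> S (\<lambda>x. u x + v x) = S u + S v"
  and S_scale: "u \<in> L2 \<Longrightarrow> S (\<lambda>x. c * u x) = c *\<^sub>R S u"
  using S_bounded_linear unfolding bounded_linear_on_Lp_def by blast+

lemma S_diff: "u \<in> L2 \<Longrightarrow> v \<in> L2 \<Longrightarrow> S (\<lambda>x. u x - v x) = S u - S v"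
  using S_add[of u "\<lambda>x. (-1) * v x"] S_scale[of v "-1"] Lp_2_scale[of v M "-1"] by simp

lemma S_square_bound: "\<exists>C\<ge>0. \<forall>u\<in>L2. (norm (S u))\<^sup>2 \<le> C * (\<integral>x. (u x)\<^sup>2 \<partial>M)"
proof -
  obtain C where C: "\<And>u. u \<in> L2 \<Longrightarrow> norm (S u) \<le> C * Lp_norm M 2 u"
    using S_bounded_linear unfolding bounded_linear_on_Lp_def by blast
  have "(norm (S u))\<^sup>2 \<le> C\<^sup>2 * (\<integral>x. (u x)\<^sup>2 \<partial>M)" if "u \<in> L2" for u
    using power_mono[OF C[OF that] norm_ge_zero, of 2] by (simp add: power_mult_distrib Lp_norm_2_square)
  then show ?thesis by (intro exI[of _ "C\<^sup>2"]) auto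
qed

text \<open>
  \<open>S\<close> acts on functions rather than on classes; its bound by the seminorm makes it blind to null sets.
\<close>

lemma S_cong_AE:
  assumes u: "u \<in> L2" and v: "v \<in> L2" and "AE x in M. u x = v x"
  shows "S u = S v"
proof -
  obtain C where C: "C \<ge> 0" "\<And>u. u \<in> L2 \<Longrightarrow> (norm (S u))\<^sup>2 \<le> C * (\<integral>x. (u x)\<^sup>2 \<partial>M)"
    using S_square_bound by blast
  have "(\<integral>x. (u x - v x)\<^sup>2 \<partial>M) = 0"
    using assms(3) by (intro integral_eq_zero_AE) auto
  then have "(norm (S u - S v))\<^sup>2 \<le> 0"
    using C(2)[OF Lp_2_diff[OF u v]] by (simp add: S_diff[OF u v])
  then show ?thesis by simp
qed

lemma inner_S: "u \<in> L2 \<Longrightarrow> S u \<bullet> y = (\<integral>x. u x * Sadj y x \<partial>M)"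
  and Sadj_L2: "Sadj y \<in> L2"
  using S_adjoint unfolding is_L2_adjoint_def by blast+

text \<open>
  The controls of finite cost.  This set does not depend on the set \<open>A\<close> in the cost, because \<open>\<beta>\<close> is integrable.
\<close>

definition feasible :: "('a \<Rightarrow> real) set" where
  "feasible = {u \<in> L2. (AE x in M. u x \<in> eff_dom g) \<and> integrable M (\<lambda>x. gr (u x))}"

definition state :: "'a set \<Rightarrow> ('a \<Rightarrow> real) \<Rightarrow> 'y" where
  "state A u = S (\<lambda>x. indicator A x * u x)"

definition real_cost :: "'a set \<Rightarrow> ('a \<Rightarrow> real) \<Rightarrow> real" where
  "real_cost A u = 1 / 2 * (norm (state A u - yd))\<^sup>2 + (\<integral>x. gr (u x) \<partial>M) + (\<integral>x. indicator A x * \<beta> x \<partial>M)"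

lemma feasible_L2: "u \<in> feasible \<Longrightarrow> u \<in> L2"
  and feasible_dom: "u \<in> feasible \<Longrightarrow> AE x in M. u x \<in> eff_dom g"
  and feasible_integrable: "u \<in> feasible \<Longrightarrow> integrable M (\<lambda>x. gr (u x))"
  by (simp_all add: feasible_def)

lemma zero_feasible: "(\<lambda>x. 0) \<in> feasible"
  by (simp add: feasible_def Lp_2_zero dom_0 gr_0)

lemma g_comp_measurable:
  "u \<in> L2 \<Longrightarrow> (\<lambda>x. g (u x)) \<in> borel_measurable M"
  "u \<in> L2 \<Longrightarrow> (\<lambda>x. gr (u x)) \<in> borel_measurable M"
  by (auto dest!: Lp_2_measurable)

lemma e2ennreal_g: "u \<in> eff_dom g \<Longrightarrow> e2ennreal (g u) = ennreal (gr u)"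
  using g_eq_gr[of u] by (cases "g u") (auto simp: e2ennreal_ereal)

text \<open>
  Finite integral of \<open>g\<close> as an extended nonnegative function forces the control into the effective domain almost
  everywhere.  This form fits the conclusion of Fatou's lemma.
\<close>

lemma feasibleI:
  assumes u: "u \<in> L2" and "(\<integral>\<^sup>+x. e2ennreal (g (u x)) \<partial>M) \<le> ennreal c" "0 \<le> c"
  shows "u \<in> feasible" "(\<integral>x. gr (u x) \<partial>M) \<le> c"
proof -
  note [measurable] = g_comp_measurable[OF u]
  have "(\<integral>\<^sup>+x. e2ennreal (g (u x)) \<partial>M) \<noteq> \<infinity>" using assms(2) by (auto simp: top_unique)
  then have "AE x in M. e2ennreal (g (u x)) \<noteq> \<infinity>" by (intro nn_integral_PInf_AE) auto
  then have dom: "AE x in M. u x \<in> eff_dom g"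
    by eventually_elim (auto simp: eff_dom_def)
  have eq: "(\<integral>\<^sup>+x. e2ennreal (g (u x)) \<partial>M) = (\<integral>\<^sup>+x. ennreal (gr (u x)) \<partial>M)"
    using dom by (intro nn_integral_cong_AE) (auto simp: e2ennreal_g)
  have int: "integrable M (\<lambda>x. gr (u x))"
    using assms(2) unfolding eq by (intro integrableI_nonneg) (auto simp: gr_nonneg less_top[symmetric] top_unique)
  show "u \<in> feasible" using u dom int by (simp add: feasible_def)
  show "(\<integral>x. gr (u x) \<partial>M) \<le> c"
    using assms(2,3) unfolding eq by (subst (asm) nn_integral_eq_integral[OF int]) (auto simp: gr_nonneg)
qed

lemma nn_integral_g:
  assumes u: "u \<in> feasible"
  shows "(\<integral>\<^sup>+x. e2ennreal (g (u x)) \<partial>M) = ennreal (\<integral>x. gr (u x) \<partial>M)"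
proof -
  have "(\<integral>\<^sup>+x. e2ennreal (g (u x)) \<partial>M) = (\<integral>\<^sup>+x. ennreal (gr (u x)) \<partial>M)"
    using feasible_dom[OF u] by (intro nn_integral_cong_AE) (auto simp: e2ennreal_g)
  then show ?thesis using feasible_integrable[OF u] by (simp add: nn_integral_eq_integral gr_nonneg)
qed

lemma cost_feasible:
  assumes A: "A \<in> sets lebesgue" and u: "u \<in> feasible"
  shows "cost \<Omega> S yd g \<beta> u A = ereal (real_cost A u)"
proof -
  have i: "integrable M (\<lambda>x. indicator A x * \<beta> x)" by (rule integrable_indicator_mult[OF A \<beta>_integrable])
  have "ext_integral M (\<lambda>x. g (u x) + ereal (indicator A x * \<beta> x)) = ereal (\<integral>x. gr (u x) + indicator A x * \<beta> x \<partial>M)"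
  proof (rule ext_integral_eq_integral)
    show "integrable M (\<lambda>x. gr (u x) + indicator A x * \<beta> x)"
      using i feasible_integrable[OF u] by (rule Bochner_Integration.integrable_add[rotated])
    show "AE x in M. g (u x) + ereal (indicator A x * \<beta> x) = ereal (gr (u x) + indicator A x * \<beta> x)"
      using feasible_dom[OF u] by eventually_elim (metis g_eq_gr plus_ereal.simps(1))
  qed
  also have "(\<integral>x. gr (u x) + indicator A x * \<beta> x \<partial>M) = (\<integral>x. gr (u x) \<partial>M) + (\<integral>x. indicator A x * \<beta> x \<partial>M)"
    using i feasible_integrable[OF u] by (rule Bochner_Integration.integral_add[rotated])
  finally show ?thesis by (simp add: cost_def real_cost_def state_def)
qed

text \<open>
  The negative part of the integrand is at most \<open>\<bar>\<beta>\<bar>\<close>, since \<open>g \<ge> 0\<close>; so the subtraction in the extended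
  integral is never \<open>\<infinity> - \<infinity>\<close>, and the positive part is infinite whenever the integral of \<open>g\<close> is.
\<close>

lemma cost_infeasible:
  assumes A: "A \<in> sets lebesgue" and u: "u \<in> L2" "u \<notin> feasible"
  shows "cost \<Omega> S yd g \<beta> u A = \<infinity>"
proof -
  note [measurable] = g_comp_measurable[OF u(1)]
  let ?b = "\<lambda>x. indicator A x * \<beta> x" and ?f = "\<lambda>x. g (u x) + ereal (indicator A x * \<beta> x)"
  have i: "integrable M ?b" by (rule integrable_indicator_mult[OF A \<beta>_integrable])
  then have [measurable]: "?b \<in> borel_measurable M" by auto
  have b: "(\<integral>\<^sup>+x. ennreal \<bar>?b x\<bar> \<partial>M) = ennreal (\<integral>x. \<bar>?b x\<bar> \<partial>M)"
    using i by (intro nn_integral_eq_integral) auto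
  have neg: "e2ennreal (- ?f x) \<le> ennreal \<bar>?b x\<bar>" for x
  proof -
    have "- ?f x \<le> ereal \<bar>?b x\<bar>"
      using nonneg[of "u x"] by (cases "g (u x)") auto
    then show ?thesis by (metis e2ennreal_ereal e2ennreal_mono)
  qed
  have pos: "e2ennreal (g (u x)) \<le> e2ennreal (?f x) + ennreal \<bar>?b x\<bar>" for x
  proof (cases "g (u x)")
    case (real r)
    have "ennreal r \<le> ennreal (r + ?b x) + ennreal \<bar>?b x\<bar>"
    proof (cases "0 \<le> r + ?b x")
      case True
      have "ennreal r \<le> ennreal ((r + ?b x) + \<bar>?b x\<bar>)"
        using abs_ge_minus_self[of "?b x"] by (intro ennreal_leI) linarith
      then show ?thesis using True by (subst (asm) ennreal_plus) auto
    next
      case False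
      then have "ennreal r \<le> ennreal \<bar>?b x\<bar>" by (intro ennreal_leI) linarith
      then show ?thesis using add_increasing[of "ennreal (r + ?b x)"] by simp
    qed
    then show ?thesis using real by (simp add: e2ennreal_ereal)
  qed (use nonneg[of "u x"] in auto)
  have "(\<integral>\<^sup>+x. e2ennreal (?f x) \<partial>M) = \<infinity>"
  proof (rule ccontr)
    assume "(\<integral>\<^sup>+x. e2ennreal (?f x) \<partial>M) \<noteq> \<infinity>"
    then obtain c where c: "0 \<le> c" "(\<integral>\<^sup>+x. e2ennreal (?f x) \<partial>M) = ennreal c"
      by (cases "\<integral>\<^sup>+x. e2ennreal (?f x) \<partial>M") auto
    have "(\<integral>\<^sup>+x. e2ennreal (g (u x)) \<partial>M) \<le> (\<integral>\<^sup>+x. e2ennreal (?f x) + ennreal \<bar>?b x\<bar> \<partial>M)"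
      by (intro nn_integral_mono pos)
    also have "\<dots> = (\<integral>\<^sup>+x. e2ennreal (?f x) \<partial>M) + (\<integral>\<^sup>+x. ennreal \<bar>?b x\<bar> \<partial>M)"
      by (intro nn_integral_add) measurable
    also have "\<dots> = ennreal (c + (\<integral>x. \<bar>?b x\<bar> \<partial>M))" using c b by simp
    finally have "u \<in> feasible" by (rule feasibleI(1)[OF u(1)]) (use c(1) in simp)
    then show False using u(2) by simp
  qed
  moreover have "(\<integral>\<^sup>+x. e2ennreal (- ?f x) \<partial>M) \<noteq> \<infinity>"
  proof -
    have "(\<integral>\<^sup>+x. e2ennreal (- ?f x) \<partial>M) \<le> ennreal (\<integral>x. \<bar>?b x\<bar> \<partial>M)"
      unfolding b[symmetric] by (intro nn_integral_mono neg)
    then show ?thesis by (auto simp: top_unique)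
  qed
  then obtain c where "0 \<le> c" "(\<integral>\<^sup>+x. e2ennreal (- ?f x) \<partial>M) = ennreal c"
    by (cases "\<integral>\<^sup>+x. e2ennreal (- ?f x) \<partial>M") auto
  ultimately have "ext_integral M ?f = \<infinity>" by (simp add: ext_integral_def)
  then show ?thesis by (simp add: cost_def)
qed

lemma state_add_scale:
  assumes A: "A \<in> sets lebesgue" and u: "u \<in> L2" and v: "v \<in> L2"
  shows "state A (\<lambda>x. s * u x + t * v x) = s *\<^sub>R state A u + t *\<^sub>R state A v"
proof -
  note Au = Lp_2_indicator_mult[OF A u] and Av = Lp_2_indicator_mult[OF A v]
  have "(\<lambda>x. indicator A x * (s * u x + t * v x)) = (\<lambda>x. s * (indicator A x * u x) + t * (indicator A x * v x))"
    by (simp add: algebra_simps fun_eq_iff)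
  then show ?thesis
    unfolding state_def using S_add[OF Lp_2_scale[OF Au, of s] Lp_2_scale[OF Av, of t]] S_scale[OF Au] S_scale[OF Av] by simp
qed

lemma inner_state:
  assumes A: "A \<in> sets lebesgue" and u: "u \<in> L2"
  shows "state A u \<bullet> y = (\<integral>x. indicator A x * u x * Sadj y x \<partial>M)"
  unfolding state_def using inner_S[OF Lp_2_indicator_mult[OF A u]] by simp

lemma feasible_convex:
  assumes u: "u \<in> feasible" and v: "v \<in> feasible" and t: "0 < t" "t < 1"
  defines "w \<equiv> \<lambda>x. t * u x + (1 - t) * v x"
  shows "w \<in> feasible"
    and "\<mu> / 2 * t * (1 - t) * (\<integral>x. (u x - v x)\<^sup>2 \<partial>M) + (\<integral>x. gr (w x) \<partial>M)
      \<le> t * (\<integral>x. gr (u x) \<partial>M) + (1 - t) * (\<integral>x. gr (v x) \<partial>M)"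
proof -
  note iu = feasible_integrable[OF u] and iv = feasible_integrable[OF v]
  have w: "w \<in> L2"
    unfolding w_def by (intro Lp_2_add Lp_2_scale feasible_L2 u v)
  have pt: "AE x in M. w x \<in> eff_dom g \<and>
      \<mu> / 2 * t * (1 - t) * (u x - v x)\<^sup>2 + gr (w x) \<le> t * gr (u x) + (1 - t) * gr (v x)"
    using feasible_dom[OF u] feasible_dom[OF v]
    by eventually_elim (use strongly_convex_gr[OF _ _ t] in \<open>auto simp: w_def\<close>)
  have bnd: "integrable M (\<lambda>x. t * gr (u x) + (1 - t) * gr (v x))" using iu iv by auto
  have iw: "integrable M (\<lambda>x. gr (w x))"
  proof (rule Bochner_Integration.integrable_bound[OF bnd g_comp_measurable(2)[OF w]])
    show "AE x in M. norm (gr (w x)) \<le> norm (t * gr (u x) + (1 - t) * gr (v x))"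
      using pt
    proof eventually_elim
      case (elim x)
      have "0 \<le> \<mu> / 2 * t * (1 - t) * (u x - v x)\<^sup>2" using mu t by simp
      then have "gr (w x) \<le> t * gr (u x) + (1 - t) * gr (v x)" using elim by linarith
      also have "\<dots> \<le> \<bar>t * gr (u x) + (1 - t) * gr (v x)\<bar>" by (rule abs_ge_self)
      finally show ?case by (simp only: real_norm_def abs_of_nonneg[OF gr_nonneg])
    qed
  qed
  show "w \<in> feasible" using w pt iw by (simp add: feasible_def)
  have sq: "integrable M (\<lambda>x. (u x - v x)\<^sup>2)"
    using feasible_L2[OF u] feasible_L2[OF v] by (intro Lp_2_integrable_square Lp_2_diff)
  have "\<mu> / 2 * t * (1 - t) * (\<integral>x. (u x - v x)\<^sup>2 \<partial>M) + (\<integral>x. gr (w x) \<partial>M)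
      = (\<integral>x. \<mu> / 2 * t * (1 - t) * (u x - v x)\<^sup>2 + gr (w x) \<partial>M)"
    using sq iw by simp
  also have "\<dots> \<le> (\<integral>x. t * gr (u x) + (1 - t) * gr (v x) \<partial>M)"
    using pt sq iw bnd by (intro integral_mono_AE) auto
  also have "\<dots> = t * (\<integral>x. gr (u x) \<partial>M) + (1 - t) * (\<integral>x. gr (v x) \<partial>M)"
    using iu iv by simp
  finally show "\<mu> / 2 * t * (1 - t) * (\<integral>x. (u x - v x)\<^sup>2 \<partial>M) + (\<integral>x. gr (w x) \<partial>M)
      \<le> t * (\<integral>x. gr (u x) \<partial>M) + (1 - t) * (\<integral>x. gr (v x) \<partial>M)" .
qed

lemma e2ennreal_g_lsc:
  assumes "x \<longlonglongrightarrow> u" shows "e2ennreal (g u) \<le> liminf (\<lambda>n. e2ennreal (g (x n)))"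
  unfolding le_Liminf_iff
proof (intro allI impI)
  have *: "y < e2ennreal (g v) \<longleftrightarrow> enn2ereal y < g v" for y v
    using nonneg[of v] by (simp add: less_ennreal.rep_eq enn2ereal_e2ennreal)
  fix y assume "y < e2ennreal (g u)"
  then have "enn2ereal y < liminf (\<lambda>n. g (x n))"
    using lsc_sequentially[OF assms] unfolding * by (rule order_less_le_trans)
  then show "eventually (\<lambda>n. y < e2ennreal (g (x n))) sequentially"
    unfolding * by (rule less_LiminfD)
qed

text \<open>
  Strong convexity of \<open>g\<close> gives the midpoint inequality for the cost with squared \<open>L\<^sup>2\<close> distance; the tracking term only
  contributes convexity (parallelogram law).  With tolerances \<open>(1/4)\<^sup>n\<close> the minimising sequence converges both in
  \<open>L\<^sup>2\<close>, which gives convergence of the states, and almost everywhere, which allows Fatou's lemma for \<open>g\<close>.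
\<close>

lemma minimizer_exists:
  assumes A: "A \<in> sets lebesgue"
  shows "\<exists>u\<in>feasible. \<forall>v\<in>feasible. real_cost A u \<le> real_cost A v"
proof -
  let ?b = "\<integral>x. indicator A x * \<beta> x \<partial>M"
  have below: "?b \<le> real_cost A u" for u
    unfolding real_cost_def using Bochner_Integration.integral_nonneg[of M "\<lambda>x. gr (u x)"] gr_nonneg by simp
  have mid: "\<exists>w\<in>feasible. real_cost A w + \<mu> / 8 * (\<integral>x. (u x - v x)\<^sup>2 \<partial>M) \<le> (real_cost A u + real_cost A v) / 2"
    if u: "u \<in> feasible" and v: "v \<in> feasible" for u v
  proof
    let ?w = "\<lambda>x. 1/2 * u x + (1 - 1/2) * v x"
    show "?w \<in> feasible" by (rule feasible_convex(1)[OF u v]) auto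
    have 1: "\<mu> / 2 * (1/2) * (1 - 1/2) * (\<integral>x. (u x - v x)\<^sup>2 \<partial>M) + (\<integral>x. gr (?w x) \<partial>M)
      \<le> 1/2 * (\<integral>x. gr (u x) \<partial>M) + (1 - 1/2) * (\<integral>x. gr (v x) \<partial>M)"
      by (rule feasible_convex(2)[OF u v]) auto
    have 2: "(norm (state A ?w - yd))\<^sup>2 \<le> 1/2 * (norm (state A u - yd))\<^sup>2 + 1/2 * (norm (state A v - yd))\<^sup>2"
    proof -
      let ?a = "state A u - yd" and ?c = "state A v - yd"
      have "state A ?w - yd = (1/2) *\<^sub>R (?a + ?c)"
        unfolding state_add_scale[OF A feasible_L2[OF u] feasible_L2[OF v]]
        by (simp add: algebra_simps flip: scaleR_add_left)
      then have "(norm (state A ?w - yd))\<^sup>2 = (norm (?a + ?c))\<^sup>2 / 4" by (simp add: power_divide)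
      moreover have "(norm (?a + ?c))\<^sup>2 + (norm (?a - ?c))\<^sup>2 = 2 * (norm ?a)\<^sup>2 + 2 * (norm ?c)\<^sup>2"
        unfolding power2_norm_eq_inner by (simp add: inner_add inner_diff inner_commute)
      ultimately show ?thesis using zero_le_power2[of "norm (?a - ?c)"] by linarith
    qed
    show "real_cost A ?w + \<mu> / 8 * (\<integral>x. (u x - v x)\<^sup>2 \<partial>M) \<le> (real_cost A u + real_cost A v) / 2"
      using 1 2 unfolding real_cost_def by simp
  qed
  have ne: "feasible \<noteq> {}" using zero_feasible by blast
  have pos: "(1/4 :: real) ^ n > 0" for n by simp
  obtain u m where u: "\<And>n. u n \<in> feasible" and m: "\<And>v. v \<in> feasible \<Longrightarrow> m \<le> real_cost A v"
    and um: "\<And>n. real_cost A (u n) \<le> m + (1/4) ^ n"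
    and cauchy: "\<And>n k. \<mu> / 8 * (\<integral>x. (u n x - u k x)\<^sup>2 \<partial>M) \<le> max ((1/4) ^ n) ((1/4) ^ k)"
    using minimizing_sequence[where f = "real_cost A" and d = "\<lambda>u v. \<mu> / 8 * (\<integral>x. (u x - v x)\<^sup>2 \<partial>M)"
      and \<epsilon> = "\<lambda>n. (1/4) ^ n", OF ne below mid pos] by blast
  have "(\<integral>x. (u n x - u k x)\<^sup>2 \<partial>M) \<le> 8 / \<mu> * max ((1/4) ^ n) ((1/4) ^ k)" for n k
    using cauchy[of n k] mu by (simp add: field_simps)
  from Lp_2_limit[OF finite_measure_axioms feasible_L2[OF u] this]
  obtain v where v: "v \<in> L2" and ae: "AE x in M. (\<lambda>n. u n x) \<longlonglongrightarrow> v x"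
    and l2: "(\<lambda>n. \<integral>x. (u n x - v x)\<^sup>2 \<partial>M) \<longlonglongrightarrow> 0" by blast
  have st: "(\<lambda>n. state A (u n)) \<longlonglongrightarrow> state A v"
  proof -
    obtain C where C: "C \<ge> 0" "\<And>u. u \<in> L2 \<Longrightarrow> (norm (S u))\<^sup>2 \<le> C * (\<integral>x. (u x)\<^sup>2 \<partial>M)"
      using S_square_bound by blast
    have le: "(norm (state A (u n) - state A v))\<^sup>2 \<le> C * (\<integral>x. (u n x - v x)\<^sup>2 \<partial>M)" for n
    proof -
      have d: "(\<lambda>x. u n x - v x) \<in> L2" by (intro Lp_2_diff feasible_L2 u v)
      have "state A (u n) - state A v = S (\<lambda>x. indicator A x * (u n x - v x))"
        unfolding state_def right_diff_distrib
        by (intro S_diff[symmetric] Lp_2_indicator_mult A feasible_L2 u v)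
      then have "(norm (state A (u n) - state A v))\<^sup>2 \<le> C * (\<integral>x. (indicator A x * (u n x - v x))\<^sup>2 \<partial>M)"
        using C(2)[OF Lp_2_indicator_mult[OF A d]] by simp
      also have "\<dots> \<le> C * (\<integral>x. (u n x - v x)\<^sup>2 \<partial>M)"
        using d A by (intro mult_left_mono C(1) integral_mono Lp_2_integrable_square Lp_2_indicator_mult)
          (auto simp: indicator_def)
      finally show ?thesis .
    qed
    have "(\<lambda>n. (norm (state A (u n) - state A v))\<^sup>2) \<longlonglongrightarrow> 0"
      by (rule tendsto_sandwich[where f = "\<lambda>_. 0" and h = "\<lambda>n. C * (\<integral>x. (u n x - v x)\<^sup>2 \<partial>M)"])
        (use le in \<open>auto intro: tendsto_mult_right_zero l2\<close>)
    then have "(\<lambda>n. sqrt ((norm (state A (u n) - state A v))\<^sup>2)) \<longlonglongrightarrow> sqrt 0" by (rule tendsto_real_sqrt)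
    then have "(\<lambda>n. norm (state A (u n) - state A v)) \<longlonglongrightarrow> 0" by simp
    then show ?thesis by (simp add: tendsto_norm_zero_iff LIM_zero_iff)
  qed
  \<comment> \<open>Solving the near-minimality inequality for the integral of \<open>g\<close> isolates the one term that is only lower semicontinuous.\<close>
  define c where "c = (\<lambda>n. m + (1/4) ^ n - 1/2 * (norm (state A (u n) - yd))\<^sup>2 - ?b)"
  define c' where "c' = m + 0 - 1/2 * (norm (state A v - yd))\<^sup>2 - ?b"
  have cle: "(\<integral>x. gr (u n x) \<partial>M) \<le> c n" for n
    using um[of n] unfolding c_def real_cost_def by simp
  have lim: "c \<longlonglongrightarrow> c'"
    unfolding c_def c'_def by (intro tendsto_intros st LIMSEQ_realpow_zero) auto
  have "0 \<le> c n" for n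
    using cle[of n] Bochner_Integration.integral_nonneg[of M "\<lambda>x. gr (u n x)"] gr_nonneg by (meson order_trans)
  then have c'0: "0 \<le> c'" using lim by (intro LIMSEQ_le_const) auto
  have "(\<integral>\<^sup>+x. e2ennreal (g (v x)) \<partial>M) \<le> (\<integral>\<^sup>+x. liminf (\<lambda>n. e2ennreal (g (u n x))) \<partial>M)"
    using ae by (intro nn_integral_mono_AE) (auto intro: e2ennreal_g_lsc)
  also have "\<dots> \<le> liminf (\<lambda>n. \<integral>\<^sup>+x. e2ennreal (g (u n x)) \<partial>M)"
    by (intro nn_integral_liminf measurable_compose[OF _ measurable_e2ennreal] g_comp_measurable(1) feasible_L2 u)
  also have "\<dots> \<le> liminf (\<lambda>n. ennreal (c n))"
    unfolding nn_integral_g[OF u] by (intro Liminf_mono always_eventually allI ennreal_leI cle)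
  also have "\<dots> = ennreal c'"
    by (intro lim_imp_Liminf tendsto_ennrealI lim) simp
  finally have "v \<in> feasible" "(\<integral>x. gr (v x) \<partial>M) \<le> c'"
    using feasibleI[OF v _ c'0] by blast+
  moreover from this(2) have "real_cost A v \<le> m" by (simp add: real_cost_def c'_def)
  ultimately show ?thesis using m by (meson order_trans)
qed

lemma value_function_eq:
  assumes A: "A \<in> sets lebesgue" and u: "u \<in> feasible" and min: "\<And>v. v \<in> feasible \<Longrightarrow> real_cost A u \<le> real_cost A v"
  shows "value_function \<Omega> S yd g \<beta> A = real_cost A u"
  unfolding value_function_def
proof (rule min_value_eqI)
  show "u \<in> L2" by (rule feasible_L2[OF u])
  show "cost \<Omega> S yd g \<beta> u A = ereal (real_cost A u)" by (rule cost_feasible[OF A u])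
  fix v assume "v \<in> L2"
  then show "ereal (real_cost A u) \<le> cost \<Omega> S yd g \<beta> v A"
    using cost_infeasible[OF A] cost_feasible[OF A] min by (cases "v \<in> feasible") auto
qed

lemma value_function_attained:
  assumes A: "A \<in> sets lebesgue"
  obtains u where "u \<in> feasible" "value_function \<Omega> S yd g \<beta> A = real_cost A u"
  using minimizer_exists[OF A] value_function_eq[OF A] by blast

lemma value_function_le:
  assumes A: "A \<in> sets lebesgue" and v: "v \<in> feasible"
  shows "value_function \<Omega> S yd g \<beta> A \<le> real_cost A v"
  using minimizer_exists[OF A] value_function_eq[OF A] v by fastforce

end

section \<open>Controls with small support\<close>

text \<open>
  Below the threshold \<open>a\<close> the first summand suffices; above it \<open>\<bar>t\<bar> powr (2 - q)\<close> is at most \<open>a powr (2 - q)\<close>.  Integrated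
  over a small set, this replaces Hoelder's inequality.
\<close>

lemma square_le_threshold:
  fixes a q t :: real
  assumes "a > 0" "q > 2"
  shows "t\<^sup>2 \<le> a\<^sup>2 + a powr (2 - q) * \<bar>t\<bar> powr q"
proof (cases "\<bar>t\<bar> \<le> a")
  case True
  then have "t\<^sup>2 \<le> a\<^sup>2" using power_mono[OF True, of 2] by simp
  then show ?thesis by (simp add: add_increasing2)
next
  case False
  then have t: "a < \<bar>t\<bar>" by simp
  then have "t\<^sup>2 = \<bar>t\<bar> powr (2 - q) * \<bar>t\<bar> powr q"
    using assms(1) by (simp add: powr_numeral flip: powr_add)
  also have "\<dots> \<le> a powr (2 - q) * \<bar>t\<bar> powr q"
    using t assms by (intro mult_right_mono powr_mono2') auto
  finally show ?thesis by (simp add: add_increasing)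
qed

context control_problem
begin

text \<open>
  Write \<open>\<parallel>S v\<parallel>\<^sup>2\<close> as the integral of \<open>v * f\<close> with \<open>f = S\<^sup>*S v\<close> and split the product by Young's inequality.  On the small
  set \<open>E\<close>, \<open>f\<^sup>2\<close> has small integral relative to \<open>n\<^sup>2 = \<parallel>v\<parallel>\<^sup>2\<close>, because the norm of \<open>f\<close> in \<open>L\<^sup>q\<close> is at most
  \<open>C n\<close>: compare \<open>\<bar>f\<bar>\<close> with the threshold \<open>K n\<close>.  The constant \<open>K\<close> is chosen so large that the part above the
  threshold, of size \<open>C\<^sup>q K powr (2 - q) n\<^sup>2\<close>, is small, and then \<open>E\<close> so small that the part below it,
  \<open>K\<^sup>2 n\<^sup>2\<close> times the measure of \<open>E\<close>, is small too.
\<close>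

lemma S_small_on_small_sets:
  assumes q: "q > 2" and T: "bounded_linear_Lp_Lq M 2 q (\<lambda>u. Sadj (S u))" and "\<epsilon> > 0"
  obtains \<delta> where "\<delta> > 0"
    "\<And>E v. \<lbrakk>E \<in> sets M; measure M E < \<delta>; v \<in> L2; \<And>x. x \<notin> E \<Longrightarrow> v x = 0\<rbrakk>
        \<Longrightarrow> (norm (S v))\<^sup>2 \<le> \<epsilon> * (\<integral>x. (v x)\<^sup>2 \<partial>M)"
proof -
  obtain C0 where C0: "\<And>u. u \<in> L2 \<Longrightarrow> Lp_norm M q (Sadj (S u)) \<le> C0 * Lp_norm M 2 u"
    and Tq: "\<And>u. u \<in> L2 \<Longrightarrow> Sadj (S u) \<in> Lp M q"
    using T unfolding bounded_linear_Lp_Lq_def by blast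
  define C where "C = \<bar>C0\<bar>"
  have norm_nonneg: "0 \<le> Lp_norm M r u" for r u by (simp add: Lp_norm_def)
  have C: "Lp_norm M q (Sadj (S u)) \<le> C * Lp_norm M 2 u" if "u \<in> L2" for u
    using C0[OF that] mult_right_mono[OF abs_ge_self[of C0] norm_nonneg[of 2 u]] unfolding C_def by linarith
  \<comment> \<open>With this \<open>z\<close>, the threshold \<open>K\<close> below satisfies \<open>(C powr q + 1) * K powr (2 - q) = \<epsilon>\<^sup>2 / 2\<close>; the summand 1 keeps \<open>K\<close> positive when \<open>C = 0\<close>.\<close>
  define z where "z = 2 * (C powr q + 1) / \<epsilon>\<^sup>2"
  have z: "z > 0" using \<open>\<epsilon> > 0\<close> by (simp add: z_def add_nonneg_pos)
  define K where "K = z powr (1 / (q - 2))"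
  have K: "K > 0" using z by (simp add: K_def)
  have "K powr (2 - q) = z powr (- 1)"
    unfolding K_def powr_powr using q by (intro arg_cong[where f = "\<lambda>e. z powr e"]) (simp add: field_simps)
  also have "\<dots> = \<epsilon>\<^sup>2 / (2 * (C powr q + 1))" using z by (simp add: powr_minus_divide z_def)
  finally have Kq: "K powr (2 - q) = \<epsilon>\<^sup>2 / (2 * (C powr q + 1))" .
  have "C powr q * K powr (2 - q) \<le> (C powr q + 1) * (\<epsilon>\<^sup>2 / (2 * (C powr q + 1)))"
    unfolding Kq by (intro mult_right_mono) auto
  also have "\<dots> = \<epsilon>\<^sup>2 / 2"
  proof -
    have "C powr q + 1 > 0" by (simp add: add_nonneg_pos)
    moreover have "c * (e / (2 * c)) = e / 2" if "c > 0" for c e :: real using that by simp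
    ultimately show ?thesis by blast
  qed
  finally have CK: "C powr q * K powr (2 - q) \<le> \<epsilon>\<^sup>2 / 2" .
  show thesis
  proof
    show "\<epsilon>\<^sup>2 / (2 * K\<^sup>2) > 0" using \<open>\<epsilon> > 0\<close> K by simp
    fix E and v :: "'a \<Rightarrow> real"
    assume E: "E \<in> sets M" "measure M E < \<epsilon>\<^sup>2 / (2 * K\<^sup>2)" and v: "v \<in> L2" and v0: "\<And>x. x \<notin> E \<Longrightarrow> v x = 0"
    have E\<Omega>: "E \<inter> \<Omega> = E" using sets.sets_into_space[OF E(1)] by auto
    have KE: "K\<^sup>2 * measure M E \<le> \<epsilon>\<^sup>2 / 2" using E(2) K by (simp add: field_simps)
    define n where "n = Lp_norm M 2 v"
    have nsq: "n\<^sup>2 = (\<integral>x. (v x)\<^sup>2 \<partial>M)" unfolding n_def by (rule Lp_norm_2_square)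
    show "(norm (S v))\<^sup>2 \<le> \<epsilon> * (\<integral>x. (v x)\<^sup>2 \<partial>M)"
    proof (cases "n = 0")
      case True
      obtain C' where "(norm (S v))\<^sup>2 \<le> C' * (\<integral>x. (v x)\<^sup>2 \<partial>M)" using S_square_bound v by blast
      then show ?thesis using True nsq by simp
    next
      case False
      then have n: "n > 0" using norm_nonneg[of 2 v] by (simp add: n_def)
      define f where "f = Sadj (S v)"
      have fq: "integrable M (\<lambda>x. \<bar>f x\<bar> powr q)" using Tq[OF v] by (simp add: Lp_def f_def)
      have fL2: "f \<in> L2" unfolding f_def by (rule Sadj_L2)
      have fn: "(\<integral>x. \<bar>f x\<bar> powr q \<partial>M) \<le> (C * n) powr q"
      proof -
        have "(\<integral>x. \<bar>f x\<bar> powr q \<partial>M) = (Lp_norm M q f) powr q"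
          using q by (simp add: Lp_norm_def powr_powr)
        also have "\<dots> \<le> (C * n) powr q"
          using C[OF v] q norm_nonneg unfolding f_def n_def by (intro powr_mono2) auto
        finally show ?thesis .
      qed
      let ?r = "\<lambda>x. (K * n)\<^sup>2 * indicator E x + (K * n) powr (2 - q) * \<bar>f x\<bar> powr q"
      have pt: "v x * f x \<le> \<epsilon> / 2 * (v x)\<^sup>2 + 1 / (2 * \<epsilon>) * ?r x" for x
      proof (cases "x \<in> E")
        case True
        have "0 \<le> (\<epsilon> * v x - f x)\<^sup>2" by simp
        then have "2 * \<epsilon> * (v x * f x) \<le> \<epsilon>\<^sup>2 * (v x)\<^sup>2 + (f x)\<^sup>2"
          by (simp add: power2_eq_square algebra_simps)
        also have "\<dots> = 2 * \<epsilon> * (\<epsilon> / 2 * (v x)\<^sup>2 + 1 / (2 * \<epsilon>) * (f x)\<^sup>2)"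
          using \<open>\<epsilon> > 0\<close> by (simp add: power2_eq_square field_simps)
        finally have "v x * f x \<le> \<epsilon> / 2 * (v x)\<^sup>2 + 1 / (2 * \<epsilon>) * (f x)\<^sup>2"
          using \<open>\<epsilon> > 0\<close> by (simp del: times_divide_eq_left)
        also have "(f x)\<^sup>2 \<le> ?r x"
          using square_le_threshold[of "K * n" q "f x"] K n q True by simp
        finally show ?thesis using \<open>\<epsilon> > 0\<close> by (simp add: divide_right_mono)
      next
        case False
        then show ?thesis using v0[OF False] \<open>\<epsilon> > 0\<close> by simp
      qed
      have ir: "integrable M ?r"
        using E(1) fq by (intro Bochner_Integration.integrable_add integrable_mult_right) (auto simp: emeasure_eq_measure)
      have "(norm (S v))\<^sup>2 = (\<integral>x. v x * f x \<partial>M)"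
        unfolding power2_norm_eq_inner f_def by (rule inner_S[OF v])
      also have "\<dots> \<le> (\<integral>x. \<epsilon> / 2 * (v x)\<^sup>2 + 1 / (2 * \<epsilon>) * ?r x \<partial>M)"
        using pt by (intro integral_mono Bochner_Integration.integrable_add integrable_mult_right
            Lp_2_integrable_mult Lp_2_integrable_square v fL2 ir)
      also have "\<dots> = \<epsilon> / 2 * n\<^sup>2 + 1 / (2 * \<epsilon>) * (\<integral>x. ?r x \<partial>M)"
        unfolding nsq using ir Lp_2_integrable_square[OF v]
        by (subst Bochner_Integration.integral_add) (auto simp del: times_divide_eq_left)
      also have "(\<integral>x. ?r x \<partial>M) = (K * n)\<^sup>2 * measure M E + (K * n) powr (2 - q) * (\<integral>x. \<bar>f x\<bar> powr q \<partial>M)"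
        using E(1) fq by (subst Bochner_Integration.integral_add) (auto simp: emeasure_eq_measure E\<Omega>)
      also have "\<dots> \<le> n\<^sup>2 * (\<epsilon>\<^sup>2 / 2) + n\<^sup>2 * (\<epsilon>\<^sup>2 / 2)"
      proof (rule add_mono)
        have "n\<^sup>2 * (K\<^sup>2 * measure M E) \<le> n\<^sup>2 * (\<epsilon>\<^sup>2 / 2)" using KE by (intro mult_left_mono) auto
        then show "(K * n)\<^sup>2 * measure M E \<le> n\<^sup>2 * (\<epsilon>\<^sup>2 / 2)" by (simp add: power_mult_distrib mult_ac)
        have "n powr (2 - q) * n powr q = n\<^sup>2" using n by (simp add: powr_numeral flip: powr_add)
        then have "(K * n) powr (2 - q) * (C * n) powr q = n\<^sup>2 * (C powr q * K powr (2 - q))"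
          using K n by (simp add: powr_mult C_def mult_ac)
        also have "\<dots> \<le> n\<^sup>2 * (\<epsilon>\<^sup>2 / 2)" using CK by (intro mult_left_mono) auto
        finally have "(K * n) powr (2 - q) * (C * n) powr q \<le> n\<^sup>2 * (\<epsilon>\<^sup>2 / 2)" .
        moreover have "(K * n) powr (2 - q) * (\<integral>x. \<bar>f x\<bar> powr q \<partial>M) \<le> (K * n) powr (2 - q) * (C * n) powr q"
          using fn by (intro mult_left_mono) auto
        ultimately show "(K * n) powr (2 - q) * (\<integral>x. \<bar>f x\<bar> powr q \<partial>M) \<le> n\<^sup>2 * (\<epsilon>\<^sup>2 / 2)" by linarith
      qed
      also have "\<epsilon> / 2 * n\<^sup>2 + 1 / (2 * \<epsilon>) * (n\<^sup>2 * (\<epsilon>\<^sup>2 / 2) + n\<^sup>2 * (\<epsilon>\<^sup>2 / 2)) = \<epsilon> * n\<^sup>2"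
        using \<open>\<epsilon> > 0\<close> by (simp add: field_simps power2_eq_square)
      finally show ?thesis using \<open>\<epsilon> > 0\<close> by (simp add: nsq divide_right_mono)
    qed
  qed
qed

end

section \<open>Expansion of the value function around a solution\<close>

locale solved_control_problem = control_problem g \<mu> \<Omega> S Sadj yd \<beta>
  for g \<mu> and \<Omega> :: "'a::euclidean_space set" and S :: "('a \<Rightarrow> real) \<Rightarrow> 'y::real_inner" and Sadj yd \<beta> +
  fixes B :: "'a set" and u p :: "'a \<Rightarrow> real" and y :: 'y
  assumes B_sets: "B \<in> sets lebesgue" and B_subset: "B \<subseteq> \<Omega>"
    and solution: "is_solution \<Omega> S Sadj yd g \<beta> B u y p"
begin

abbreviation V :: "'a set \<Rightarrow> real" where "V \<equiv> value_function \<Omega> S yd g \<beta>"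

text \<open>
  The control that a maximum principle suggests: on \<open>B\<close> it turns out to agree with \<open>u\<close>, and off \<open>B\<close> it is the
  control to use where the set is enlarged.
\<close>

definition w :: "'a \<Rightarrow> real" where "w x = pointwise_min (p x)"

text \<open>
  The switching function: the density of the first-order change of the value function when points are added to the set.
\<close>

definition h :: "'a \<Rightarrow> real" where "h x = \<beta> x + H_bar g (p x)"

text \<open>
  The part of the expanded cost that depends neither on the control nor on the set.
\<close>

definition offset :: real where "offset = 1/2 * (norm (y - yd))\<^sup>2 - y \<bullet> (y - yd)"

lemma p_L2: "p \<in> L2" and p_eq: "AE x in M. p x = Sadj (y - yd) x" and y_eq: "y = state B u"
  using solution unfolding is_solution_def state_def by auto

lemma p_measurable [measurable]: "p \<in> borel_measurable M"
  by (rule Lp_2_measurable[OF p_L2])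

lemma u_feasible: "u \<in> feasible"
  and u_minimal: "v \<in> feasible \<Longrightarrow> real_cost B u \<le> real_cost B v"
proof -
  have uL2: "u \<in> L2" and min: "\<And>v. v \<in> L2 \<Longrightarrow> \<not> cost \<Omega> S yd g \<beta> v B < cost \<Omega> S yd g \<beta> u B"
    using solution unfolding is_solution_def is_arg_min_def by auto
  show u: "u \<in> feasible"
  proof (rule ccontr)
    assume "u \<notin> feasible"
    then show False
      using min[OF feasible_L2[OF zero_feasible]] cost_infeasible[OF B_sets uL2] cost_feasible[OF B_sets zero_feasible]
      by simp
  qed
  show "real_cost B u \<le> real_cost B v" if "v \<in> feasible" for v
    using min[OF feasible_L2[OF that]] cost_feasible[OF B_sets that] cost_feasible[OF B_sets u] by simp
qed

lemma w_L2: "w \<in> L2"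
proof (rule Lp_2_dominated[OF p_L2])
  show "w \<in> borel_measurable M" unfolding w_def by measurable
  show "\<bar>w x\<bar> \<le> 1 / \<mu> * \<bar>p x\<bar>" for x using abs_pointwise_min_le[of "p x"] by (simp add: w_def)
qed

lemma H_bar_w: "H_bar g (p x) = p x * w x + gr (w x)"
  by (simp add: w_def H_bar_eq)

lemma H_bar_integrable: "integrable M (\<lambda>x. H_bar g (p x))"
proof (rule Bochner_Integration.integrable_bound)
  show "integrable M (\<lambda>x. (p x)\<^sup>2 / \<mu>)" using Lp_2_integrable_square[OF p_L2] by simp
  show "AE x in M. norm (H_bar g (p x)) \<le> norm ((p x)\<^sup>2 / \<mu>)" using abs_H_bar_le mu by simp
qed measurable

lemma h_integrable: "integrable M h"
  unfolding h_def[abs_def] using \<beta>_integrable H_bar_integrable by (rule Bochner_Integration.integrable_add)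

lemma gr_indicator_mult: "gr (indicator A x * v) = indicator A x * gr v"
  by (auto simp: indicator_def gr_0)

lemma w_feasible:
  assumes A: "A \<in> sets lebesgue" shows "(\<lambda>x. indicator A x * w x) \<in> feasible"
proof -
  have "integrable M (\<lambda>x. H_bar g (p x) - p x * w x)"
    using H_bar_integrable Lp_2_integrable_mult[OF p_L2 w_L2] by (rule Bochner_Integration.integrable_diff)
  then have "integrable M (\<lambda>x. gr (w x))" by (simp add: H_bar_w)
  then have "integrable M (\<lambda>x. gr (indicator A x * w x))"
    unfolding gr_indicator_mult by (rule integrable_indicator_mult[OF A])
  moreover have "indicator A x * w x \<in> eff_dom g" for x
    using dom_0 pointwise_min_dom by (auto simp: indicator_def w_def)
  ultimately show ?thesis using Lp_2_indicator_mult[OF A w_L2] by (simp add: feasible_def)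
qed

lemma inner_state_p:
  assumes A: "A \<in> sets lebesgue" and v: "v \<in> L2"
  shows "state A v \<bullet> (y - yd) = (\<integral>x. indicator A x * p x * v x \<partial>M)"
proof -
  have "state A v \<bullet> (y - yd) = (\<integral>x. indicator A x * v x * Sadj (y - yd) x \<partial>M)"
    by (rule inner_state[OF A v])
  also have "\<dots> = (\<integral>x. indicator A x * p x * v x \<partial>M)"
  proof (rule integral_cong_AE)
    show "(\<lambda>x. indicator A x * v x * Sadj (y - yd) x) \<in> borel_measurable M"
      using A v Sadj_L2 by (intro borel_measurable_times indicator_lebesgue_on Lp_2_measurable)
    show "(\<lambda>x. indicator A x * p x * v x) \<in> borel_measurable M"
      using A v by (intro borel_measurable_times indicator_lebesgue_on p_measurable Lp_2_measurable)
    show "AE x in M. indicator A x * v x * Sadj (y - yd) x = indicator A x * p x * v x"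
      using p_eq by eventually_elim simp
  qed
  finally show ?thesis .
qed

lemma indicator_p_integrable:
  assumes A: "A \<in> sets lebesgue" and v: "v \<in> L2"
  shows "integrable M (\<lambda>x. indicator A x * p x * v x)"
  using integrable_indicator_mult[OF A Lp_2_integrable_mult[OF p_L2 v]] by (simp add: mult.assoc)

text \<open>
  The exact second-order Taylor expansion of the tracking term around \<open>y\<close>, with its linear part rewritten through the
  adjoint.
\<close>

lemma real_cost_expansion:
  assumes A: "A \<in> sets lebesgue" and v: "v \<in> feasible"
  shows "real_cost A v = offset + 1/2 * (norm (state A v - y))\<^sup>2
    + (\<integral>x. indicator A x * p x * v x + gr (v x) \<partial>M) + (\<integral>x. indicator A x * \<beta> x \<partial>M)"
proof -
  let ?z = "state A v"
  have sq: "(norm (a + b))\<^sup>2 = (norm a)\<^sup>2 + 2 * (b \<bullet> a) + (norm b)\<^sup>2" for a b :: 'y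
    by (simp add: power2_norm_eq_inner inner_add_left inner_add_right inner_commute)
  have "?z - yd = (y - yd) + (?z - y)" by simp
  then have "(norm (?z - yd))\<^sup>2 = (norm (y - yd))\<^sup>2 + 2 * ((?z - y) \<bullet> (y - yd)) + (norm (?z - y))\<^sup>2"
    by (simp only: sq)
  moreover have "(?z - y) \<bullet> (y - yd) = (\<integral>x. indicator A x * p x * v x \<partial>M) - y \<bullet> (y - yd)"
    using inner_state_p[OF A feasible_L2[OF v]] by (simp add: inner_diff_left)
  moreover have "(\<integral>x. indicator A x * p x * v x + gr (v x) \<partial>M)
      = (\<integral>x. indicator A x * p x * v x \<partial>M) + (\<integral>x. gr (v x) \<partial>M)"
    using indicator_p_integrable[OF A feasible_L2[OF v]] feasible_integrable[OF v]
    by (rule Bochner_Integration.integral_add)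
  ultimately show ?thesis unfolding real_cost_def offset_def by (simp add: algebra_simps)
qed

text \<open>
  Along the segment from \<open>u\<close> to \<open>v\<close> the integral is convex and the remaining term of the expansion is quadratic in the
  step \<open>t\<close>, because it vanishes at \<open>u\<close>; as \<open>t\<close> tends to 0 only the integrals survive.
\<close>

lemma variational_inequality:
  assumes v: "v \<in> feasible"
  shows "(\<integral>x. indicator B x * p x * u x + gr (u x) \<partial>M) \<le> (\<integral>x. indicator B x * p x * v x + gr (v x) \<partial>M)"
proof -
  note Bu = indicator_p_integrable[OF B_sets feasible_L2[OF u_feasible]] and Bv = indicator_p_integrable[OF B_sets feasible_L2[OF v]]
  let ?F = "\<lambda>v. \<integral>x. indicator B x * p x * v x + gr (v x) \<partial>M"
  let ?N = "1/2 * (norm (state B v - y))\<^sup>2"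
  have F: "?F v = (\<integral>x. indicator B x * p x * v x \<partial>M) + (\<integral>x. gr (v x) \<partial>M)" if "v \<in> feasible" for v
    using indicator_p_integrable[OF B_sets feasible_L2[OF that]] feasible_integrable[OF that]
    by (rule Bochner_Integration.integral_add)
  have "?F u + ?N \<le> ?F v + ?N"
  proof (rule growth_at_minimum)
    fix t :: real assume t: "0 < t" "t < 1"
    let ?v = "\<lambda>x. t * v x + (1 - t) * u x"
    note fv = feasible_convex[OF v u_feasible t]
    have "state B ?v - y = t *\<^sub>R (state B v - y)"
      unfolding state_add_scale[OF B_sets feasible_L2[OF v] feasible_L2[OF u_feasible]] y_eq by (simp add: algebra_simps)
    then have n: "(norm (state B ?v - y))\<^sup>2 = t\<^sup>2 * (norm (state B v - y))\<^sup>2" by (simp add: power_mult_distrib)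
    have l: "(\<integral>x. indicator B x * p x * ?v x \<partial>M)
        = t * (\<integral>x. indicator B x * p x * v x \<partial>M) + (1 - t) * (\<integral>x. indicator B x * p x * u x \<partial>M)"
    proof -
      have "(\<integral>x. indicator B x * p x * ?v x \<partial>M)
        = (\<integral>x. t * (indicator B x * p x * v x) + (1 - t) * (indicator B x * p x * u x) \<partial>M)"
        by (simp add: algebra_simps)
      also have "\<dots> = t * (\<integral>x. indicator B x * p x * v x \<partial>M) + (1 - t) * (\<integral>x. indicator B x * p x * u x \<partial>M)"
        using Bu Bv by (subst Bochner_Integration.integral_add) auto
      finally show ?thesis .
    qed
    have "0 \<le> \<mu> / 2 * t * (1 - t) * (\<integral>x. (v x - u x)\<^sup>2 \<partial>M)" using mu t by simp
    then have "(\<integral>x. gr (?v x) \<partial>M) \<le> t * (\<integral>x. gr (v x) \<partial>M) + (1 - t) * (\<integral>x. gr (u x) \<partial>M)"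
      using fv(2) by linarith
    then have "?F ?v \<le> t * ?F v + (1 - t) * ?F u"
      unfolding F[OF fv(1)] F[OF v] F[OF u_feasible] l by (simp add: algebra_simps)
    moreover have "?F u \<le> ?F ?v + 1/2 * (t\<^sup>2 * (norm (state B v - y))\<^sup>2)"
      using u_minimal[OF fv(1)] unfolding real_cost_expansion[OF B_sets fv(1)] real_cost_expansion[OF B_sets u_feasible] n
      by (simp add: y_eq)
    ultimately have "?F u \<le> t * ?F v + (1 - t) * ?F u + 1/2 * (t\<^sup>2 * (norm (state B v - y))\<^sup>2)" by linarith
    moreover have "?N * t * (1 - t) = t * ?N - 1/2 * (t\<^sup>2 * (norm (state B v - y))\<^sup>2)"
      by (simp add: power2_eq_square field_simps)
    moreover have "t * (?F v + ?N) = t * ?F v + t * ?N" by (rule distrib_left)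
    ultimately show "?F u + ?N * t * (1 - t) \<le> t * (?F v + ?N) + (1 - t) * ?F u" by linarith
  qed
  then show ?thesis by simp
qed

lemma integral_w:
  assumes A: "A \<in> sets lebesgue"
  shows "(\<integral>x. indicator A x * p x * (indicator A x * w x) + gr (indicator A x * w x) \<partial>M)
    = (\<integral>x. indicator A x * H_bar g (p x) \<partial>M)"
  unfolding gr_indicator_mult H_bar_w by (intro Bochner_Integration.integral_cong) (auto simp: indicator_def)

lemma H_bar_le_integrand:
  assumes "v \<in> eff_dom g"
  shows "indicator A x * H_bar g (p x) + \<mu> / 2 * (indicator A x * (v - w x)\<^sup>2) \<le> indicator A x * p x * v + gr v"
  using pointwise_min_growth[OF assms, of "p x"] gr_nonneg[of v]
  by (cases "x \<in> A") (auto simp: H_bar_eq w_def)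

text \<open>
  The variational inequality with \<open>v = \<chi>\<^sub>B w\<close> says that \<open>u\<close> does at least as well in the integral as the pointwise
  minimiser.  The quadratic growth of the integrand leaves no room for a difference between the two on \<open>B\<close>.
\<close>

lemma u_eq_w: "AE x in M. indicator B x * u x = indicator B x * w x"
  and integral_u: "(\<integral>x. indicator B x * p x * u x + gr (u x) \<partial>M) = (\<integral>x. indicator B x * H_bar g (p x) \<partial>M)"
proof -
  let ?d = "\<lambda>x. indicator B x * (u x - w x)\<^sup>2"
  have i1: "integrable M (\<lambda>x. indicator B x * H_bar g (p x))"
    by (rule integrable_indicator_mult[OF B_sets H_bar_integrable])
  have i2: "integrable M ?d"
    by (intro integrable_indicator_mult[OF B_sets] Lp_2_integrable_square Lp_2_diff feasible_L2 u_feasible w_L2)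
  have i3: "integrable M (\<lambda>x. indicator B x * p x * u x + gr (u x))"
    by (intro Bochner_Integration.integrable_add indicator_p_integrable B_sets feasible_L2 feasible_integrable u_feasible)
  have "(\<integral>x. indicator B x * H_bar g (p x) \<partial>M) + \<mu> / 2 * (\<integral>x. ?d x \<partial>M)
      = (\<integral>x. indicator B x * H_bar g (p x) + \<mu> / 2 * ?d x \<partial>M)"
    using i1 i2 by simp
  also have "\<dots> \<le> (\<integral>x. indicator B x * p x * u x + gr (u x) \<partial>M)"
  proof (rule integral_mono_AE)
    show "integrable M (\<lambda>x. indicator B x * H_bar g (p x) + \<mu> / 2 * ?d x)"
      by (intro Bochner_Integration.integrable_add integrable_mult_right i1 i2)
    show "AE x in M. indicator B x * H_bar g (p x) + \<mu> / 2 * ?d x \<le> indicator B x * p x * u x + gr (u x)"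
      using feasible_dom[OF u_feasible] by eventually_elim (rule H_bar_le_integrand)
  qed (rule i3)
  finally have 1: "(\<integral>x. indicator B x * H_bar g (p x) \<partial>M) + \<mu> / 2 * (\<integral>x. ?d x \<partial>M)
      \<le> (\<integral>x. indicator B x * p x * u x + gr (u x) \<partial>M)" .
  have 2: "(\<integral>x. indicator B x * p x * u x + gr (u x) \<partial>M) \<le> (\<integral>x. indicator B x * H_bar g (p x) \<partial>M)"
    using variational_inequality[OF w_feasible[OF B_sets]] unfolding integral_w[OF B_sets] .
  have 3: "0 \<le> (\<integral>x. ?d x \<partial>M)" by (intro Bochner_Integration.integral_nonneg) auto
  have "\<mu> / 2 * (\<integral>x. ?d x \<partial>M) \<le> 0" using 1 2 by linarith
  then have 4: "(\<integral>x. ?d x \<partial>M) = 0" using 3 mu by (simp add: mult_le_0_iff)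
  show "(\<integral>x. indicator B x * p x * u x + gr (u x) \<partial>M) = (\<integral>x. indicator B x * H_bar g (p x) \<partial>M)"
    using 1 2 unfolding 4 by simp
  have "AE x in M. ?d x = 0"
    using integral_nonneg_eq_0_iff_AE[OF i2] 4 by auto
  then show "AE x in M. indicator B x * u x = indicator B x * w x"
    by eventually_elim auto
qed

lemma y_eq_state_w: "y = S (\<lambda>x. indicator B x * w x)"
  unfolding y_eq state_def
  by (intro S_cong_AE Lp_2_indicator_mult B_sets feasible_L2 u_feasible w_L2 u_eq_w)

lemma integral_indicator_h:
  assumes A: "A \<in> sets lebesgue"
  shows "(\<integral>x. indicator A x * h x \<partial>M) = (\<integral>x. indicator A x * H_bar g (p x) \<partial>M) + (\<integral>x. indicator A x * \<beta> x \<partial>M)"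
  unfolding h_def distrib_left
  using integrable_indicator_mult[OF A H_bar_integrable] integrable_indicator_mult[OF A \<beta>_integrable] by simp

lemma value_function_solution: "V B = offset + (\<integral>x. indicator B x * h x \<partial>M)"
  using value_function_eq[OF B_sets u_feasible u_minimal] 
  unfolding real_cost_expansion[OF B_sets u_feasible] integral_u integral_indicator_h[OF B_sets] 
  by (simp add: y_eq)

text \<open>
  Drop the square in the expansion and minimise the integrand pointwise; outside \<open>A\<close> this uses \<open>g \<ge> 0\<close>.
\<close>

lemma value_function_lower_bound:
  assumes A: "A \<in> sets lebesgue"
  shows "offset + (\<integral>x. indicator A x * h x \<partial>M) \<le> V A"
proof -
  obtain v where v: "v \<in> feasible" "V A = real_cost A v" using value_function_attained[OF A] by blast
  have "(\<integral>x. indicator A x * H_bar g (p x) \<partial>M) \<le> (\<integral>x. indicator A x * p x * v x + gr (v x) \<partial>M)"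
  proof (rule integral_mono_AE)
    show "AE x in M. indicator A x * H_bar g (p x) \<le> indicator A x * p x * v x + gr (v x)"
      using feasible_dom[OF v(1)]
    proof eventually_elim
      case (elim x)
      have "0 \<le> \<mu> / 2 * (indicator A x * (v x - w x)\<^sup>2)" using mu by simp
      then show ?case using H_bar_le_integrand[OF elim, of A x] by linarith
    qed
  qed (intro integrable_indicator_mult A H_bar_integrable Bochner_Integration.integrable_add
      indicator_p_integrable feasible_L2 feasible_integrable v)+
  then show ?thesis
    unfolding v(2) real_cost_expansion[OF A v(1)] integral_indicator_h[OF A] by (simp add: add_increasing)
qed

text \<open>
  Insert the control \<open>\<chi>\<^sub>A w\<close>: it minimises the integrand, so that only the square in the expansion remains, and there
  \<open>y = S (\<chi>\<^sub>B w)\<close>.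
\<close>

lemma value_function_upper_bound:
  assumes A: "A \<in> sets lebesgue"
  shows "V A \<le> offset + (\<integral>x. indicator A x * h x \<partial>M)
    + 1/2 * (norm (S (\<lambda>x. (indicator A x - indicator B x) * w x)))\<^sup>2"
proof -
  let ?v = "\<lambda>x. indicator A x * w x"
  have "state A ?v = S ?v"
    unfolding state_def by (intro arg_cong[where f = S]) (auto simp: indicator_def)
  then have "state A ?v - y = S (\<lambda>x. (indicator A x - indicator B x) * w x)"
    using S_diff[OF Lp_2_indicator_mult[OF A w_L2] Lp_2_indicator_mult[OF B_sets w_L2]] y_eq_state_w
    by (simp add: left_diff_distrib)
  then show ?thesis
    using value_function_le[OF A w_feasible[OF A]]
    unfolding real_cost_expansion[OF A w_feasible[OF A]] integral_w[OF A] integral_indicator_h[OF A] by simp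
qed

end

section \<open>The topological derivative\<close>

lemma content_ball_tendsto_0:
  fixes x :: "'a::euclidean_space"
  shows "((\<lambda>r. measure lebesgue (ball x r)) \<longlongrightarrow> 0) (at_right 0)"
proof -
  have "((\<lambda>r::real. unit_ball_vol (real DIM('a)) * r ^ DIM('a)) \<longlongrightarrow> 0) (at_right 0)"
    by (intro tendsto_mult_right_zero tendsto_null_power tendsto_ident_at DIM_positive)
  moreover have "eventually (\<lambda>r. unit_ball_vol (real DIM('a)) * r ^ DIM('a) = measure lebesgue (ball x r)) (at_right 0)"
    using eventually_at_right_less[of 0] by eventually_elim (simp add: content_ball)
  ultimately show ?thesis by (rule Lim_transform_eventually)
qed

context solved_control_problem
begin

text \<open>
  Adding and removing a ball are treated together.  The set \<open>E\<close> is where the ball can have an effect, namely \<open>\<Omega> - B\<close> with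
  \<open>s = 1\<close> or \<open>B\<close> with \<open>s = -1\<close>.  The two bounds on the value function leave, after division by the measure of
  the ball, an error of at most \<open>\<epsilon>/2\<close> times a mean of \<open>w\<^sup>2\<close>.
\<close>

lemma difference_quotient_tendsto:
  assumes q: "q > 2" "bounded_linear_Lp_Lq M 2 q (\<lambda>u. Sadj (S u))"
    and E: "E \<in> sets lebesgue" "E \<subseteq> \<Omega>"
    and A: "\<And>r. A r \<in> sets lebesgue"
    and diff: "\<And>r z. indicator (A r) z - indicator B z = s * (indicator (ball x r) z * indicator E z :: real)"
    and s: "\<bar>s\<bar> = 1"
    and h_point: "((\<lambda>r. (LINT z:ball x r|lebesgue. indicator E z * h z) / measure lebesgue (ball x r)) \<longlongrightarrow> l) (at_right 0)"
    and w_point: "((\<lambda>r. (LINT z:ball x r|lebesgue. indicator \<Omega> z * (w z)\<^sup>2) / measure lebesgue (ball x r)) \<longlongrightarrow> l') (at_right 0)"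
  shows "((\<lambda>r. (V (A r) - V B) / measure lebesgue (ball x r)) \<longlongrightarrow> s * l) (at_right 0)"
proof -
  have \<Omega>': "\<Omega> \<inter> space lebesgue \<in> sets lebesgue" using \<Omega>_sets by simp
  define m where "m = (\<lambda>r. measure lebesgue (ball x r))"
  define H where "H = (\<lambda>r. LINT z:ball x r|lebesgue. indicator E z * h z)"
  define W where "W = (\<lambda>r. LINT z:ball x r|lebesgue. indicator \<Omega> z * (w z)\<^sup>2)"
  define v where "v = (\<lambda>r z. (indicator (A r) z - indicator B z) * w z)"
  have m: "m r > 0" if "r > 0" for r using content_ball_pos[OF that, of x] by (simp add: m_def)
  have main: "(\<integral>z. indicator (A r) z * h z \<partial>M) - (\<integral>z. indicator B z * h z \<partial>M) = s * H r" for r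
  proof -
    have "(\<integral>z. indicator (A r) z * h z \<partial>M) - (\<integral>z. indicator B z * h z \<partial>M)
        = (\<integral>z. indicator (A r) z * h z - indicator B z * h z \<partial>M)"
      by (intro Bochner_Integration.integral_diff[symmetric] integrable_indicator_mult A B_sets h_integrable)
    also have "\<dots> = (\<integral>z. s * (indicator (ball x r) z * indicator E z * h z) \<partial>M)"
      using diff[of r] by (simp add: mult.assoc flip: left_diff_distrib)
    also have "\<dots> = (\<integral>z. indicator \<Omega> z *\<^sub>R (s * (indicator (ball x r) z * indicator E z * h z)) \<partial>lebesgue)"
      by (rule integral_restrict_space[OF \<Omega>'])
    also have "\<dots> = (\<integral>z. s * (indicator (ball x r) z *\<^sub>R (indicator E z * h z)) \<partial>lebesgue)"
      using E(2) by (intro Bochner_Integration.integral_cong) (auto simp: indicator_def)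
    finally show ?thesis by (simp add: H_def set_lebesgue_integral_def)
  qed
  have vL2: "v r \<in> L2" for r
    unfolding v_def left_diff_distrib by (intro Lp_2_diff Lp_2_indicator_mult A B_sets w_L2)
  have vW: "(\<integral>z. (v r z)\<^sup>2 \<partial>M) \<le> W r" for r
  proof -
    have "(\<integral>z. (v r z)\<^sup>2 \<partial>M) \<le> (\<integral>z. indicator (ball x r) z * (w z)\<^sup>2 \<partial>M)"
    proof (rule integral_mono)
      show "integrable M (\<lambda>z. (v r z)\<^sup>2)" by (rule Lp_2_integrable_square[OF vL2])
      show "integrable M (\<lambda>z. indicator (ball x r) z * (w z)\<^sup>2)"
        by (intro integrable_indicator_mult Lp_2_integrable_square w_L2) simp
      have "s\<^sup>2 = 1" using s by (metis power2_abs one_power2)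
      then show "(v r z)\<^sup>2 \<le> indicator (ball x r) z * (w z)\<^sup>2" for z
        unfolding v_def diff by (auto simp: indicator_def power_mult_distrib)
    qed
    also have "\<dots> = (\<integral>z. indicator \<Omega> z *\<^sub>R (indicator (ball x r) z * (w z)\<^sup>2) \<partial>lebesgue)"
      by (rule integral_restrict_space[OF \<Omega>'])
    also have "\<dots> = W r"
      unfolding W_def set_lebesgue_integral_def by (simp add: mult_ac)
    finally show ?thesis .
  qed
  have error: "\<bar>V (A r) - V B - s * H r\<bar> \<le> 1/2 * (norm (S (v r)))\<^sup>2" for r
    using value_function_lower_bound[OF A[of r]] value_function_upper_bound[OF A[of r]] value_function_solution main[of r]
    unfolding v_def by linarith
  have "((\<lambda>r. (V (A r) - V B) / m r - s * (H r / m r)) \<longlongrightarrow> 0) (at_right 0)"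
  proof (rule tendstoI)
    fix e :: real assume "e > 0"
    define \<epsilon> where "\<epsilon> = e / (\<bar>l'\<bar> + 1)"
    have c: "\<bar>l'\<bar> + 1 > 0" by simp
    have "\<epsilon> > 0" using \<open>e > 0\<close> by (simp add: \<epsilon>_def)
    have \<epsilon>_mult: "\<epsilon> * (\<bar>l'\<bar> + 1) = e"
      unfolding \<epsilon>_def using c by (intro nonzero_eq_divide_eq[THEN iffD1]) auto
    obtain \<delta> where "\<delta> > 0" and \<delta>: "\<And>E v. \<lbrakk>E \<in> sets M; measure M E < \<delta>; v \<in> L2; \<And>x. x \<notin> E \<Longrightarrow> v x = 0\<rbrakk>
        \<Longrightarrow> (norm (S v))\<^sup>2 \<le> \<epsilon> * (\<integral>x. (v x)\<^sup>2 \<partial>M)"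
      using S_small_on_small_sets[OF q \<open>\<epsilon> > 0\<close>] by blast
    have small: "eventually (\<lambda>r. m r < \<delta>) (at_right 0)"
      unfolding m_def using content_ball_tendsto_0 \<open>\<delta> > 0\<close> by (rule order_tendstoD)
    have bounded: "eventually (\<lambda>r. W r / m r < \<bar>l'\<bar> + 1) (at_right 0)"
      using w_point unfolding W_def m_def by (rule order_tendstoD) simp
    show "eventually (\<lambda>r. dist ((V (A r) - V B) / m r - s * (H r / m r)) 0 < e) (at_right 0)"
      using small bounded eventually_at_right_less[of 0]
    proof eventually_elim
      case (elim r)
      have ball: "ball x r \<inter> \<Omega> \<in> sets M"
        using \<Omega>_sets by (auto simp: sets_restrict_space)
      have "measure M (ball x r \<inter> \<Omega>) = measure lebesgue (ball x r \<inter> \<Omega>)"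
        using \<Omega>' by (intro measure_restrict_space) auto
      also have "\<dots> \<le> m r"
        unfolding m_def using \<Omega>_sets by (intro measure_mono_fmeasurable) auto
      finally have meas: "measure M (ball x r \<inter> \<Omega>) < \<delta>" using elim(1) by simp
      have "v r z = 0" if "z \<notin> ball x r \<inter> \<Omega>" for z
        using that E(2) unfolding v_def diff by (auto simp: indicator_def)
      then have "(norm (S (v r)))\<^sup>2 \<le> \<epsilon> * (\<integral>z. (v r z)\<^sup>2 \<partial>M)" by (rule \<delta>[OF ball meas vL2])
      also have "\<dots> \<le> \<epsilon> * W r" using vW \<open>\<epsilon> > 0\<close> by (intro mult_left_mono) auto
      finally have "\<bar>V (A r) - V B - s * H r\<bar> \<le> 1/2 * (\<epsilon> * W r)" using error[of r] by linarith
      then have "\<bar>V (A r) - V B - s * H r\<bar> / m r \<le> 1/2 * (\<epsilon> * W r) / m r"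
        using m[OF elim(3)] by (intro divide_right_mono) auto
      also have "\<dots> = 1/2 * \<epsilon> * (W r / m r)" by simp
      also have "\<dots> \<le> 1/2 * \<epsilon> * (\<bar>l'\<bar> + 1)"
        using elim(2) \<open>\<epsilon> > 0\<close> by (intro mult_left_mono) auto
      also have "\<dots> = e / 2" using \<epsilon>_mult by simp
      also have "\<dots> < e" using \<open>e > 0\<close> by simp
      finally have "\<bar>V (A r) - V B - s * H r\<bar> / m r < e" .
      moreover have "(V (A r) - V B) / m r - s * (H r / m r) = (V (A r) - V B - s * H r) / m r"
        by (simp add: diff_divide_distrib)
      ultimately show ?case using m[OF elim(3)] by (simp add: abs_divide)
    qed
  qed
  moreover have "((\<lambda>r. s * (H r / m r)) \<longlongrightarrow> s * l) (at_right 0)"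
    using h_point unfolding H_def m_def by (rule tendsto_mult_left)
  ultimately have "((\<lambda>r. ((V (A r) - V B) / m r - s * (H r / m r)) + s * (H r / m r)) \<longlongrightarrow> 0 + s * l) (at_right 0)"
    by (rule tendsto_add)
  then show ?thesis by (simp add: m_def)
qed

text \<open>
  A point works if it is a Lebesgue point of \<open>h\<close> restricted to \<open>B\<close>, of \<open>h\<close> restricted to \<open>\<Omega> - B\<close>, and of \<open>w\<^sup>2\<close>, all
  extended by zero.
\<close>

theorem topological_derivative:
  assumes q: "q > 2" "bounded_linear_Lp_Lq M 2 q (\<lambda>u. Sadj (S u))"
  shows "AE x in M. has_topological_derivative \<Omega> V B x (top_sign B x * h x)"
proof -
  have \<Omega>': "\<Omega> \<inter> space lebesgue \<in> sets lebesgue" using \<Omega>_sets by simp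
  have extend: "integrable lebesgue (\<lambda>z. indicator \<Omega> z * f z)" if "integrable M f" for f :: "'a \<Rightarrow> real"
    using that integrable_restrict_space[OF \<Omega>', of f] by simp
  have int: "integrable lebesgue (\<lambda>z. indicator E z * h z)" if "E \<in> sets lebesgue" "E \<subseteq> \<Omega>" for E
  proof -
    have "(\<lambda>z. indicator \<Omega> z * (indicator E z * h z)) = (\<lambda>z. indicator E z * h z)"
      using that(2) by (auto simp: indicator_def fun_eq_iff)
    then show ?thesis using extend[OF integrable_indicator_mult[OF that(1) h_integrable]] by simp
  qed
  have D: "\<Omega> - B \<in> sets lebesgue" using \<Omega>_sets B_sets by auto
  have "AE x in lebesgue. x \<in> \<Omega> \<longrightarrow> has_topological_derivative \<Omega> V B x (top_sign B x * h x)"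
    using lebesgue_differentiation[OF int[OF B_sets B_subset]] lebesgue_differentiation[OF int[OF D Diff_subset]]
      lebesgue_differentiation[OF extend[OF Lp_2_integrable_square[OF w_L2]]]
  proof eventually_elim
    case (elim x)
    show ?case
    proof (cases "x \<in> B")
      case True
      have "((\<lambda>r. (V (B - ball x r) - V B) / measure lebesgue (ball x r)) \<longlongrightarrow> - 1 * (indicator B x * h x)) (at_right 0)"
        by (rule difference_quotient_tendsto[OF q B_sets B_subset _ _ _ elim(1) elim(3)])
          (use B_sets in \<open>auto simp: indicator_def\<close>)
      then show ?thesis using True by (simp add: has_topological_derivative_def top_sign_def)
    next
      case False
      have "((\<lambda>r. (V ((B \<union> ball x r) \<inter> \<Omega>) - V B) / measure lebesgue (ball x r)) \<longlongrightarrow> 1 * (indicator (\<Omega> - B) x * h x)) (at_right 0)"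
        by (rule difference_quotient_tendsto[OF q D Diff_subset _ _ _ elim(2) elim(3)])
          (use B_sets \<Omega>_sets B_subset in \<open>auto simp: indicator_def intro!: sets.Int sets.Un\<close>)
      then show ?thesis using False
        by (cases "x \<in> \<Omega>") (simp_all add: has_topological_derivative_def top_sign_def)
    qed
  qed
  then show ?thesis by (simp add: AE_restrict_space_iff[OF \<Omega>'])
qed

end

theorem theorem4p2:
  fixes \<Omega> B :: "(real ^ 'd) set"
    and S :: "(real ^ 'd \<Rightarrow> real) \<Rightarrow> 'y::{real_inner, complete_space}"
    and Sadj :: "'y \<Rightarrow> real ^ 'd \<Rightarrow> real"
    and yd yB :: 'y
    and g :: "real \<Rightarrow> ereal"
    and \<mu> q :: real
    and \<beta> uB pB :: "real ^ 'd \<Rightarrow> real"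
  assumes "\<Omega> \<in> sets lebesgue" and "emeasure lebesgue \<Omega> < \<infinity>"
    and "bounded_linear_on_Lp (lebesgue_on \<Omega>) 2 S"
    and "is_L2_adjoint (lebesgue_on \<Omega>) S Sadj"
    and "proper_fun g" and "convex_fun g" and "lower_semicontinuous g"
    and "\<And>u. g u \<ge> 0" and "\<And>u. g u = 0 \<longleftrightarrow> u = 0"
    and "\<mu> > 0" and "strongly_convex_fun \<mu> g"
    and "q > 6"
    and "bounded_linear_Lp_Lq (lebesgue_on \<Omega>) 2 q (\<lambda>u. Sadj (S u))"
    and "Sadj yd \<in> Lp (lebesgue_on \<Omega>) q"
    and "integrable (lebesgue_on \<Omega>) \<beta>"
    and "B \<in> sets lebesgue" and "B \<subseteq> \<Omega>"
    and "is_solution \<Omega> S Sadj yd g \<beta> B uB yB pB"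
  shows "AE x in lebesgue_on \<Omega>.
    has_topological_derivative \<Omega> (value_function \<Omega> S yd g \<beta>) B x
      (top_sign B x * (\<beta> x + H_bar g (pB x)))"
proof -
  interpret solved_control_problem g \<mu> \<Omega> S Sadj yd \<beta> B uB pB yB
    by unfold_locales (use assms in auto)
  show ?thesis
    using topological_derivative[of q] assms by (simp add: h_def)
qed

end
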